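(* For any formula $A$ of $\mathcal{L}^\omega_*$, writing $A^{HR}\equiv\exists\underline{x}\,A_{HR}(\underline{x})$, the theory $\mathrm{IL}^{\omega}_*$ proves $$\underline{x}\sqsubseteq\underline{x}'\land A_{HR}(\underline{x})\to A_{HR}(\underline{x}').$$
   Context: Fix a first-order language $\mathcal{L}$ with at least one constant symbol. Types: $G$; $\sigma\to\tau$; $\sigma^*$ ($\to$ associates to the right). Constants: function symbols of $\mathcal{L}$ (type $G\to\cdots\to G$); $\Pi_{\sigma,\tau}:\sigma\to\tau\to\sigma$; $\Sigma_{\rho,\sigma,\tau}:(\rho\to\sigma\to\tau)\to(\rho\to\sigma)\to\rho\to\tau$; $\mathfrak{s}_\sigma:\sigma\to\sigma^*$; $\cup_\sigma:\sigma^*\to\sigma^*\to\sigma^*$; $\bigcup_{\sigma,\tau}:\sigma^*\to(\sigma\to\tau^* )\to\tau^*$. Terms: constants, typed variables, applications. Atomic formulas: $\bot$, $t=_\rho q$, $t\in_\rho q$ ($q:\rho^*$), $R(t_1,\dots,t_n)$. Formulas of $\mathcal{L}^\omega_*$: closed under $\lor,\land,\to,\forall x,\exists x$ and bounded quantifiers $\forall x\in t,\exists x\in t$ ($t:\rho^*$ not containing $x:\rho$). A formula is $\exists$-free if it contains no unbounded $\exists x$. $\mathrm{IL}^{\omega}_*$ is intuitionistic predicate logic in all finite types with equality axioms ($x=x$; $x=y\land A\to A'$ for atomic $A$), $\forall x\in t\,A\leftrightarrow\forall x(x\in t\to A)$, $\exists x\in t\,A\leftrightarrow\exists x(x\in t\land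 A)$, $\Sigma xyz=xz(yz)$, $\Pi xy=x$, $w\in\mathfrak{s}x\leftrightarrow w=x$, $w\in\cup xy\leftrightarrow w\in x\lor w\in y$, $z\in x\land w\in yz\to w\in\bigcup xy$, $\bigcup(\mathfrak{s}x)y=yx$, $\bigcup(\cup xy)z=\cup(\bigcup xz)(\bigcup yz)$. A type is end-star if it has the form $\rho_1\to\cdots\to\rho_n\to\tau^*$ ($n\ge0$); for $a,b$ of such a type, $a\sqsubseteq b$ abbreviates $\forall x_1^{\rho_1}\ldots x_n^{\rho_n}\forall y(y\in ax_1\cdots x_n\to y\in bx_1\cdots x_n)$, and for tuples $\underline{x}\sqsubseteq\underline{x}'$ means $\bigwedge_i x_i\sqsubseteq x_i'$. The herbrandized modified realizability assigns to each formula $A$ a formula $A^{HR}\equiv\exists\underline{x}\,A_{HR}(\underline{x})$ with the same free variables, $A_{HR}$ $\exists$-free and $\underline{x}$ a tuple of variables of end-star types, by: for atomic $A$, $A^{HR}:\equiv A_{HR}:\equiv A$; and if $A^{HR}\equiv\exists\underline{x}A_{HR}(\underline{x})$, $B^{HR}\equiv\exists\underline{u}B_{HR}(\underline{u})$: $(A\lor B)^{HR}:\equiv\exists\underline{x},\underline{u}(A_{HR}(\underline{x})\lor B_{HR}(\underline{u}))$; $(A\land B)^{HR}:\equiv\exists\underline{x},\underline{u}(A_{HR}(\underline{x})\land B_{HR}(\underline{u}))$; $(A\to B)^{HR}:\equiv\exists\underline{U}\forall\underline{x}(A_{HR}(\underline{x})\to B_{HR}(\underline{U}\underline{x}))$;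 $(\exists z A(z))^{HR}:\equiv\exists Z,\underline{x}\,\exists z\in Z\,A_{HR}(z,\underline{x})$; $(\forall zA(z))^{HR}:\equiv\exists\underline{X}\forall z\,A_{HR}(z,\underline{X}z)$; $(\exists z\in t\,A(z))^{HR}:\equiv\exists\underline{x}\exists z\in t\,A_{HR}(z,\underline{x})$; $(\forall z\in t\,A(z))^{HR}:\equiv\exists\underline{x}\forall z\in t\,A_{HR}(z,\underline{x})$. Here $\underline{U}\underline{x}$ denotes the tuple of terms $U_i x_1\cdots x_k$. *)

theory Defs
  imports Main
begin

section \<open>Types and terms\<close>

datatype ty = G | Arr ty ty (infixr "\<rightarrow>" 60) | Star ty

text \<open>The symbols of a language form sets rather than whole types, so that a language may
  have no relation symbols.\<close>

record ('f, 'r) lang =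
  funs :: "'f set"
  rels :: "'r set"
  farity :: "'f \<Rightarrow> nat"
  rarity :: "'r \<Rightarrow> nat"

datatype 'f cst =
    FunC 'f
  | PiC ty ty
  | SigmaC ty ty ty
  | SingC ty
  | CupC ty
  | BigCupC ty ty

text \<open>Variables are de Bruijn indices; their types are given by a context, a list of types
  whose head belongs to the index 0.\<close>

datatype 'f trm = Var nat | Cst "'f cst" | App "'f trm" "'f trm" (infixl "\<cdot>" 75)

definition arrs :: "ty list \<Rightarrow> ty \<Rightarrow> ty" where
  "arrs \<rho>s \<tau> = foldr Arr \<rho>s \<tau>"

definition apps :: "'f trm \<Rightarrow> 'f trm list \<Rightarrow> 'f trm" where
  "apps t ts = foldl App t ts"

primrec cst_ty :: "('f, 'r) lang \<Rightarrow> 'f cst \<Rightarrow> ty" where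
  "cst_ty L (FunC f) = arrs (replicate (farity L f) G) G"
| "cst_ty L (PiC \<sigma> \<tau>) = \<sigma> \<rightarrow> \<tau> \<rightarrow> \<sigma>"
| "cst_ty L (SigmaC \<rho> \<sigma> \<tau>) = (\<rho> \<rightarrow> \<sigma> \<rightarrow> \<tau>) \<rightarrow> (\<rho> \<rightarrow> \<sigma>) \<rightarrow> \<rho> \<rightarrow> \<tau>"
| "cst_ty L (SingC \<sigma>) = \<sigma> \<rightarrow> Star \<sigma>"
| "cst_ty L (CupC \<sigma>) = Star \<sigma> \<rightarrow> Star \<sigma> \<rightarrow> Star \<sigma>"
| "cst_ty L (BigCupC \<sigma> \<tau>) = Star \<sigma> \<rightarrow> (\<sigma> \<rightarrow> Star \<tau>) \<rightarrow> Star \<tau>"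

primrec is_cst :: "('f, 'r) lang \<Rightarrow> 'f cst \<Rightarrow> bool" where
  "is_cst L (FunC f) \<longleftrightarrow> f \<in> funs L"
| "is_cst L (PiC \<sigma> \<tau>) \<longleftrightarrow> True"
| "is_cst L (SigmaC \<rho> \<sigma> \<tau>) \<longleftrightarrow> True"
| "is_cst L (SingC \<sigma>) \<longleftrightarrow> True"
| "is_cst L (CupC \<sigma>) \<longleftrightarrow> True"
| "is_cst L (BigCupC \<sigma> \<tau>) \<longleftrightarrow> True"

inductive typed :: "('f, 'r) lang \<Rightarrow> ty list \<Rightarrow> 'f trm \<Rightarrow> ty \<Rightarrow> bool" for L \<Gamma> where
  typed_Var: "i < length \<Gamma> \<Longrightarrow> typed L \<Gamma> (Var i) (\<Gamma> ! i)"
| typed_Cst: "is_cst L c \<Longrightarrow> typed L \<Gamma> (Cst c) (cst_ty L c)"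
| typed_App: "typed L \<Gamma> t (\<sigma> \<rightarrow> \<tau>) \<Longrightarrow> typed L \<Gamma> q \<sigma> \<Longrightarrow> typed L \<Gamma> (t \<cdot> q) \<tau>"

section \<open>Formulas\<close>

text \<open>In \<open>BForall \<tau> t A\<close> and \<open>BExists \<tau> t A\<close> only \<open>A\<close> is in the scope of the bound variable.\<close>

datatype ('f, 'r) fm =
    Bot
  | Eq ty "'f trm" "'f trm"
  | Mem ty "'f trm" "'f trm"
  | Rel 'r "'f trm list"
  | Or "('f, 'r) fm" "('f, 'r) fm"
  | And "('f, 'r) fm" "('f, 'r) fm"
  | Imp "('f, 'r) fm" "('f, 'r) fm"
  | Forall ty "('f, 'r) fm"
  | Exists ty "('f, 'r) fm"
  | BForall ty "'f trm" "('f, 'r) fm"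
  | BExists ty "'f trm" "('f, 'r) fm"

primrec wf_fm :: "('f, 'r) lang \<Rightarrow> ty list \<Rightarrow> ('f, 'r) fm \<Rightarrow> bool" where
  "wf_fm L \<Gamma> Bot \<longleftrightarrow> True"
| "wf_fm L \<Gamma> (Eq \<rho> t q) \<longleftrightarrow> typed L \<Gamma> t \<rho> \<and> typed L \<Gamma> q \<rho>"
| "wf_fm L \<Gamma> (Mem \<rho> t q) \<longleftrightarrow> typed L \<Gamma> t \<rho> \<and> typed L \<Gamma> q (Star \<rho>)"
| "wf_fm L \<Gamma> (Rel R ts) \<longleftrightarrow>
     R \<in> rels L \<and> length ts = rarity L R \<and> (\<forall>t \<in> set ts. typed L \<Gamma> t G)"
| "wf_fm L \<Gamma> (Or A B) \<longleftrightarrow> wf_fm L \<Gamma> A \<and> wf_fm L \<Gamma> B"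
| "wf_fm L \<Gamma> (And A B) \<longleftrightarrow> wf_fm L \<Gamma> A \<and> wf_fm L \<Gamma> B"
| "wf_fm L \<Gamma> (Imp A B) \<longleftrightarrow> wf_fm L \<Gamma> A \<and> wf_fm L \<Gamma> B"
| "wf_fm L \<Gamma> (Forall \<tau> A) \<longleftrightarrow> wf_fm L (\<tau> # \<Gamma>) A"
| "wf_fm L \<Gamma> (Exists \<tau> A) \<longleftrightarrow> wf_fm L (\<tau> # \<Gamma>) A"
| "wf_fm L \<Gamma> (BForall \<tau> t A) \<longleftrightarrow> typed L \<Gamma> t (Star \<tau>) \<and> wf_fm L (\<tau> # \<Gamma>) A"
| "wf_fm L \<Gamma> (BExists \<tau> t A) \<longleftrightarrow> typed L \<Gamma> t (Star \<tau>) \<and> wf_fm L (\<tau> # \<Gamma>) A"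

primrec atomic :: "('f, 'r) fm \<Rightarrow> bool" where
  "atomic Bot \<longleftrightarrow> True"
| "atomic (Eq \<rho> t q) \<longleftrightarrow> True"
| "atomic (Mem \<rho> t q) \<longleftrightarrow> True"
| "atomic (Rel R ts) \<longleftrightarrow> True"
| "atomic (Or A B) \<longleftrightarrow> False"
| "atomic (And A B) \<longleftrightarrow> False"
| "atomic (Imp A B) \<longleftrightarrow> False"
| "atomic (Forall \<tau> A) \<longleftrightarrow> False"
| "atomic (Exists \<tau> A) \<longleftrightarrow> False"
| "atomic (BForall \<tau> t A) \<longleftrightarrow> False"
| "atomic (BExists \<tau> t A) \<longleftrightarrow> False"

primrec exists_free :: "('f, 'r) fm \<Rightarrow> bool" where
  "exists_free Bot \<longleftrightarrow> True"
| "exists_free (Eq \<rho> t q) \<longleftrightarrow> True"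
| "exists_free (Mem \<rho> t q) \<longleftrightarrow> True"
| "exists_free (Rel R ts) \<longleftrightarrow> True"
| "exists_free (Or A B) \<longleftrightarrow> exists_free A \<and> exists_free B"
| "exists_free (And A B) \<longleftrightarrow> exists_free A \<and> exists_free B"
| "exists_free (Imp A B) \<longleftrightarrow> exists_free A \<and> exists_free B"
| "exists_free (Forall \<tau> A) \<longleftrightarrow> exists_free A"
| "exists_free (Exists \<tau> A) \<longleftrightarrow> False"
| "exists_free (BForall \<tau> t A) \<longleftrightarrow> exists_free A"
| "exists_free (BExists \<tau> t A) \<longleftrightarrow> exists_free A"

definition Iff :: "('f, 'r) fm \<Rightarrow> ('f, 'r) fm \<Rightarrow> ('f, 'r) fm" where
  "Iff A B = And (Imp A B) (Imp B A)"

text \<open>The empty conjunction is \<open>\<bottom> \<rightarrow> \<bottom>\<close>.\<close>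

fun Conjs :: "('f, 'r) fm list \<Rightarrow> ('f, 'r) fm" where
  "Conjs [] = Imp Bot Bot"
| "Conjs [A] = A"
| "Conjs (A # B # As) = And A (Conjs (B # As))"

definition Foralls :: "ty list \<Rightarrow> ('f, 'r) fm \<Rightarrow> ('f, 'r) fm" where
  "Foralls \<tau>s A = foldr Forall \<tau>s A"

definition Exs :: "ty list \<Rightarrow> ('f, 'r) fm \<Rightarrow> ('f, 'r) fm" where
  "Exs \<tau>s A = foldr Exists \<tau>s A"

section \<open>Substitution\<close>

primrec tsubst :: "(nat \<Rightarrow> 'f trm) \<Rightarrow> 'f trm \<Rightarrow> 'f trm" where
  "tsubst \<theta> (Var i) = \<theta> i"
| "tsubst \<theta> (Cst c) = Cst c"
| "tsubst \<theta> (t \<cdot> q) = tsubst \<theta> t \<cdot> tsubst \<theta> q"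

definition up :: "(nat \<Rightarrow> 'f trm) \<Rightarrow> nat \<Rightarrow> 'f trm" where
  "up \<theta> = case_nat (Var 0) (\<lambda>j. tsubst (\<lambda>i. Var (Suc i)) (\<theta> j))"

primrec subst :: "(nat \<Rightarrow> 'f trm) \<Rightarrow> ('f, 'r) fm \<Rightarrow> ('f, 'r) fm" where
  "subst \<theta> Bot = Bot"
| "subst \<theta> (Eq \<rho> t q) = Eq \<rho> (tsubst \<theta> t) (tsubst \<theta> q)"
| "subst \<theta> (Mem \<rho> t q) = Mem \<rho> (tsubst \<theta> t) (tsubst \<theta> q)"
| "subst \<theta> (Rel R ts) = Rel R (map (tsubst \<theta>) ts)"
| "subst \<theta> (Or A B) = Or (subst \<theta> A) (subst \<theta> B)"
| "subst \<theta> (And A B) = And (subst \<theta> A) (subst \<theta> B)"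
| "subst \<theta> (Imp A B) = Imp (subst \<theta> A) (subst \<theta> B)"
| "subst \<theta> (Forall \<tau> A) = Forall \<tau> (subst (up \<theta>) A)"
| "subst \<theta> (Exists \<tau> A) = Exists \<tau> (subst (up \<theta>) A)"
| "subst \<theta> (BForall \<tau> t A) = BForall \<tau> (tsubst \<theta> t) (subst (up \<theta>) A)"
| "subst \<theta> (BExists \<tau> t A) = BExists \<tau> (tsubst \<theta> t) (subst (up \<theta>) A)"

text \<open>A tuple \<open>x\<^sub>1, \<dots>, x\<^sub>n\<close> of variables, bound from left to right, turns a context \<open>\<Gamma>\<close>
  into \<open>rev \<tau>s @ \<Gamma>\<close>.  The list \<open>tvars k n\<close> is such a tuple \<open>[x\<^sub>1, \<dots>, x\<^sub>n]\<close> when \<open>k\<close> further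
  variables have been bound after it.  For \<open>A\<close> over \<open>rev \<tau>s @ \<Gamma>\<close> and terms \<open>ts\<close> over a
  context that extends \<open>\<Gamma>\<close> by \<open>k\<close> variables, \<open>plug ts k A\<close> is the instance \<open>A(ts)\<close>; in
  particular \<open>plug [] k\<close> is weakening by \<open>k\<close> variables and \<open>plug [t] 0 A\<close> is \<open>A(t)\<close>.\<close>

definition tvars :: "nat \<Rightarrow> nat \<Rightarrow> 'f trm list" where
  "tvars k n = map Var (rev [k..<k + n])"

definition inst :: "'f trm list \<Rightarrow> nat \<Rightarrow> nat \<Rightarrow> 'f trm" where
  "inst ts k i = (if i < length ts then rev ts ! i else Var (i - length ts + k))"

definition plug :: "'f trm list \<Rightarrow> nat \<Rightarrow> ('f, 'r) fm \<Rightarrow> ('f, 'r) fm" where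
  "plug ts k = subst (inst ts k)"

definition lift :: "nat \<Rightarrow> 'f trm \<Rightarrow> 'f trm" where
  "lift k = tsubst (inst [] k)"

section \<open>The theory IL\<close>

text \<open>Axioms are given for arbitrary terms in place of variables; the types are enforced by
  the well-formedness premise of the rule \<open>Ax\<close> below.  In \<open>eq_subst\<close> the variable 0 marks
  the replaced occurrences.\<close>

inductive axm :: "('f, 'r) fm \<Rightarrow> bool" where
  eq_refl: "axm (Eq \<rho> x x)"
| eq_subst: "atomic A \<Longrightarrow> axm (Imp (And (Eq \<rho> x y) (plug [x] 0 A)) (plug [y] 0 A))"
| bforall: "axm (Iff (BForall \<tau> t A) (Forall \<tau> (Imp (Mem \<tau> (Var 0) (lift 1 t)) A)))"
| bexists: "axm (Iff (BExists \<tau> t A) (Exists \<tau> (And (Mem \<tau> (Var 0) (lift 1 t)) A)))"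
| sigma: "axm (Eq \<tau> (Cst (SigmaC \<rho> \<sigma> \<tau>) \<cdot> x \<cdot> y \<cdot> z) (x \<cdot> z \<cdot> (y \<cdot> z)))"
| pi: "axm (Eq \<sigma> (Cst (PiC \<sigma> \<tau>) \<cdot> x \<cdot> y) x)"
| sing: "axm (Iff (Mem \<sigma> w (Cst (SingC \<sigma>) \<cdot> x)) (Eq \<sigma> w x))"
| cup: "axm (Iff (Mem \<sigma> w (Cst (CupC \<sigma>) \<cdot> x \<cdot> y)) (Or (Mem \<sigma> w x) (Mem \<sigma> w y)))"
| bigcup: "axm (Imp (And (Mem \<sigma> z x) (Mem \<tau> w (y \<cdot> z)))
                    (Mem \<tau> w (Cst (BigCupC \<sigma> \<tau>) \<cdot> x \<cdot> y)))"
| bigcup_sing: "axm (Eq (Star \<tau>) (Cst (BigCupC \<sigma> \<tau>) \<cdot> (Cst (SingC \<sigma>) \<cdot> x) \<cdot> y) (y \<cdot> x))"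
| bigcup_cup: "axm (Eq (Star \<tau>)
    (Cst (BigCupC \<sigma> \<tau>) \<cdot> (Cst (CupC \<sigma>) \<cdot> x \<cdot> y) \<cdot> z)
    (Cst (CupC \<tau>) \<cdot> (Cst (BigCupC \<sigma> \<tau>) \<cdot> x \<cdot> z) \<cdot> (Cst (BigCupC \<sigma> \<tau>) \<cdot> y \<cdot> z)))"

text \<open>Natural deduction: \<open>proves L \<Gamma> \<Phi> A\<close> says that \<open>A\<close> is derivable from the hypotheses
  \<open>\<Phi>\<close>, with the free variables typed by \<open>\<Gamma>\<close>.  When \<open>L\<close> has a constant symbol every type
  has a closed term, so that extending \<open>\<Gamma>\<close> by unused variables proves nothing new.\<close>

inductive proves ::
  "('f, 'r) lang \<Rightarrow> ty list \<Rightarrow> ('f, 'r) fm set \<Rightarrow> ('f, 'r) fm \<Rightarrow> bool" for L where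
  Ax: "axm A \<Longrightarrow> wf_fm L \<Gamma> A \<Longrightarrow> proves L \<Gamma> \<Phi> A"
| Assm: "A \<in> \<Phi> \<Longrightarrow> wf_fm L \<Gamma> A \<Longrightarrow> proves L \<Gamma> \<Phi> A"
| BotE: "proves L \<Gamma> \<Phi> Bot \<Longrightarrow> wf_fm L \<Gamma> A \<Longrightarrow> proves L \<Gamma> \<Phi> A"
| AndI: "proves L \<Gamma> \<Phi> A \<Longrightarrow> proves L \<Gamma> \<Phi> B \<Longrightarrow> proves L \<Gamma> \<Phi> (And A B)"
| AndE1: "proves L \<Gamma> \<Phi> (And A B) \<Longrightarrow> proves L \<Gamma> \<Phi> A"
| AndE2: "proves L \<Gamma> \<Phi> (And A B) \<Longrightarrow> proves L \<Gamma> \<Phi> B"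
| OrI1: "proves L \<Gamma> \<Phi> A \<Longrightarrow> wf_fm L \<Gamma> B \<Longrightarrow> proves L \<Gamma> \<Phi> (Or A B)"
| OrI2: "proves L \<Gamma> \<Phi> B \<Longrightarrow> wf_fm L \<Gamma> A \<Longrightarrow> proves L \<Gamma> \<Phi> (Or A B)"
| OrE: "proves L \<Gamma> \<Phi> (Or A B) \<Longrightarrow> proves L \<Gamma> (insert A \<Phi>) C \<Longrightarrow> proves L \<Gamma> (insert B \<Phi>) C
    \<Longrightarrow> proves L \<Gamma> \<Phi> C"
| ImpI: "proves L \<Gamma> (insert A \<Phi>) B \<Longrightarrow> wf_fm L \<Gamma> A \<Longrightarrow> proves L \<Gamma> \<Phi> (Imp A B)"
| ImpE: "proves L \<Gamma> \<Phi> (Imp A B) \<Longrightarrow> proves L \<Gamma> \<Phi> A \<Longrightarrow> proves L \<Gamma> \<Phi> B"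
| ForallI: "proves L (\<tau> # \<Gamma>) (plug [] 1 ` \<Phi>) A \<Longrightarrow> proves L \<Gamma> \<Phi> (Forall \<tau> A)"
| ForallE: "proves L \<Gamma> \<Phi> (Forall \<tau> A) \<Longrightarrow> typed L \<Gamma> t \<tau> \<Longrightarrow> proves L \<Gamma> \<Phi> (plug [t] 0 A)"
| ExistsI: "proves L \<Gamma> \<Phi> (plug [t] 0 A) \<Longrightarrow> typed L \<Gamma> t \<tau> \<Longrightarrow> wf_fm L (\<tau> # \<Gamma>) A
    \<Longrightarrow> proves L \<Gamma> \<Phi> (Exists \<tau> A)"
| ExistsE: "proves L \<Gamma> \<Phi> (Exists \<tau> A)
    \<Longrightarrow> proves L (\<tau> # \<Gamma>) (insert A (plug [] 1 ` \<Phi>)) (plug [] 1 C) \<Longrightarrow> wf_fm L \<Gamma> C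
    \<Longrightarrow> proves L \<Gamma> \<Phi> C"

section \<open>End-star types and inclusion\<close>

primrec end_star :: "ty \<Rightarrow> bool" where
  "end_star G \<longleftrightarrow> False"
| "end_star (\<rho> \<rightarrow> \<sigma>) \<longleftrightarrow> end_star \<sigma>"
| "end_star (Star \<tau>) \<longleftrightarrow> True"

text \<open>The first argument of \<open>sqsub\<close> is the type of both terms; the value at \<open>G\<close>, which is not
  end-star, is a dummy.\<close>

primrec sqsub :: "ty \<Rightarrow> 'f trm \<Rightarrow> 'f trm \<Rightarrow> ('f, 'r) fm" where
  "sqsub G a b = Bot"
| "sqsub (\<rho> \<rightarrow> \<sigma>) a b = Forall \<rho> (sqsub \<sigma> (lift 1 a \<cdot> Var 0) (lift 1 b \<cdot> Var 0))"
| "sqsub (Star \<tau>) a b = Forall \<tau> (Imp (Mem \<tau> (Var 0) (lift 1 a)) (Mem \<tau> (Var 0) (lift 1 b)))"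

definition sqsubs :: "ty list \<Rightarrow> 'f trm list \<Rightarrow> 'f trm list \<Rightarrow> ('f, 'r) fm" where
  "sqsubs \<sigma>s as bs = Conjs (map (\<lambda>(\<sigma>, a, b). sqsub \<sigma> a b) (zip \<sigma>s (zip as bs)))"

section \<open>Herbrandized modified realizability\<close>

text \<open>\<open>HRtys A\<close> lists the types of the tuple \<open>x\<close> in \<open>\<exists>x A\<^sub>H\<^sub>R(x)\<close>.  If \<open>A\<close> is a formula over
  \<open>\<Gamma>\<close>, then \<open>HRm A\<close> is its matrix \<open>A\<^sub>H\<^sub>R(x)\<close>, a formula over \<open>rev (HRtys A) @ \<Gamma>\<close>, and
  \<open>plug ts k (HRm A)\<close> is \<open>A\<^sub>H\<^sub>R(ts)\<close>.\<close>

primrec HRtys :: "('f, 'r) fm \<Rightarrow> ty list" where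
  "HRtys Bot = []"
| "HRtys (Eq \<rho> t q) = []"
| "HRtys (Mem \<rho> t q) = []"
| "HRtys (Rel R ts) = []"
| "HRtys (Or A B) = HRtys A @ HRtys B"
| "HRtys (And A B) = HRtys A @ HRtys B"
| "HRtys (Imp A B) = map (arrs (HRtys A)) (HRtys B)"
| "HRtys (Forall \<tau> A) = map (Arr \<tau>) (HRtys A)"
| "HRtys (Exists \<tau> A) = Star \<tau> # HRtys A"
| "HRtys (BForall \<tau> t A) = HRtys A"
| "HRtys (BExists \<tau> t A) = HRtys A"

primrec HRm :: "('f, 'r) fm \<Rightarrow> ('f, 'r) fm" where
  "HRm Bot = Bot"
| "HRm (Eq \<rho> t q) = Eq \<rho> t q"
| "HRm (Mem \<rho> t q) = Mem \<rho> t q"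
| "HRm (Rel R ts) = Rel R ts"
| "HRm (Or A B) =
    (let n = length (HRtys A); m = length (HRtys B); x = tvars m n; u = tvars 0 m
     in Or (plug x (n + m) (HRm A)) (plug u (n + m) (HRm B)))"
| "HRm (And A B) =
    (let n = length (HRtys A); m = length (HRtys B); x = tvars m n; u = tvars 0 m
     in And (plug x (n + m) (HRm A)) (plug u (n + m) (HRm B)))"
| "HRm (Imp A B) =
    (let n = length (HRtys A); m = length (HRtys B); U = tvars n m; x = tvars 0 n
     in Foralls (HRtys A)
          (Imp (plug x (n + m) (HRm A)) (plug (map (\<lambda>V. apps V x) U) (n + m) (HRm B))))"
| "HRm (Forall \<tau> A) =
    (let n = length (HRtys A); X = tvars 1 n; z = Var 0
     in Forall \<tau> (plug (z # map (\<lambda>Y. Y \<cdot> z) X) (n + 1) (HRm A)))"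
| "HRm (Exists \<tau> A) =
    (let n = length (HRtys A); Z = Var n; x = tvars 1 n; z = Var 0
     in BExists \<tau> Z (plug (z # x) (n + 2) (HRm A)))"
| "HRm (BForall \<tau> t A) =
    (let n = length (HRtys A); x = tvars 1 n; z = Var 0
     in BForall \<tau> (lift n t) (plug (z # x) (n + 1) (HRm A)))"
| "HRm (BExists \<tau> t A) =
    (let n = length (HRtys A); x = tvars 1 n; z = Var 0
     in BExists \<tau> (lift n t) (plug (z # x) (n + 1) (HRm A)))"

definition HR :: "('f, 'r) fm \<Rightarrow> ('f, 'r) fm" where
  "HR A = Exs (HRtys A) (HRm A)"

lemma end_star_arrs: "end_star (arrs \<rho>s \<sigma>) \<longleftrightarrow> end_star \<sigma>"
  by (induction \<rho>s) (auto simp: arrs_def)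

lemma end_star_HRtys: "\<sigma> \<in> set (HRtys A) \<Longrightarrow> end_star \<sigma>"
  by (induction A arbitrary: \<sigma>) (auto simp: end_star_arrs)

lemma exists_free_subst: "exists_free (subst \<theta> A) \<longleftrightarrow> exists_free A"
  by (induction A arbitrary: \<theta>) auto

lemma exists_free_Foralls: "exists_free (Foralls \<tau>s A) \<longleftrightarrow> exists_free A"
  by (induction \<tau>s) (auto simp: Foralls_def)

lemma exists_free_HRm: "exists_free (HRm A)"
  by (induction A) (auto simp: Let_def plug_def exists_free_subst exists_free_Foralls)

lemma typed_Var': "i < length \<Gamma> \<Longrightarrow> \<Gamma> ! i = \<tau> \<Longrightarrow> typed L \<Gamma> (Var i) \<tau>"
  using typed_Var by metis

lemma typed_tsubst:
  assumes "typed L \<Gamma> t \<tau>" "\<And>i. i < length \<Gamma> \<Longrightarrow> typed L \<Delta> (\<theta> i) (\<Gamma> ! i)"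
  shows "typed L \<Delta> (tsubst \<theta> t) \<tau>"
  using assms by (induction rule: typed.induct) (auto intro: typed.intros)

lemma typed_up:
  assumes "\<And>i. i < length \<Gamma> \<Longrightarrow> typed L \<Delta> (\<theta> i) (\<Gamma> ! i)" "i < length (\<tau> # \<Gamma>)"
  shows "typed L (\<tau> # \<Delta>) (up \<theta> i) ((\<tau> # \<Gamma>) ! i)"
proof (cases i)
  case 0
  then show ?thesis by (auto simp: up_def intro: typed_Var')
next
  case (Suc j)
  then have "typed L \<Delta> (\<theta> j) (\<Gamma> ! j)" using assms by auto
  then have "typed L (\<tau> # \<Delta>) (tsubst (\<lambda>i. Var (Suc i)) (\<theta> j)) (\<Gamma> ! j)"
    by (rule typed_tsubst) (auto intro: typed_Var')
  then show ?thesis using Suc by (simp add: up_def)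
qed

lemma wf_fm_subst:
  "wf_fm L \<Gamma> A \<Longrightarrow> (\<And>i. i < length \<Gamma> \<Longrightarrow> typed L \<Delta> (\<theta> i) (\<Gamma> ! i)) \<Longrightarrow> wf_fm L \<Delta> (subst \<theta> A)"
proof (induction A arbitrary: \<Gamma> \<Delta> \<theta>)
  case (Forall \<tau> A)
  have "wf_fm L (\<tau> # \<Delta>) (subst (up \<theta>) A)"
    using Forall.prems(1) by (intro Forall.IH[OF _ typed_up[OF Forall.prems(2)]]) auto
  then show ?case by simp
next
  case (Exists \<tau> A)
  have "wf_fm L (\<tau> # \<Delta>) (subst (up \<theta>) A)"
    using Exists.prems(1) by (intro Exists.IH[OF _ typed_up[OF Exists.prems(2)]]) auto
  then show ?case by simp
next
  case (BForall \<tau> t A)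
  have "wf_fm L (\<tau> # \<Delta>) (subst (up \<theta>) A)"
    using BForall.prems(1) by (intro BForall.IH[OF _ typed_up[OF BForall.prems(2)]]) auto
  then show ?case using BForall.prems by (auto intro: typed_tsubst)
next
  case (BExists \<tau> t A)
  have "wf_fm L (\<tau> # \<Delta>) (subst (up \<theta>) A)"
    using BExists.prems(1) by (intro BExists.IH[OF _ typed_up[OF BExists.prems(2)]]) auto
  then show ?case using BExists.prems by (auto intro: typed_tsubst)
qed (fastforce intro: typed_tsubst)+

lemma typed_inst:
  assumes "list_all2 (typed L (\<Delta> @ \<Gamma>)) ts \<tau>s" "i < length (rev \<tau>s @ \<Gamma>)"
  shows "typed L (\<Delta> @ \<Gamma>) (inst ts (length \<Delta>) i) ((rev \<tau>s @ \<Gamma>) ! i)"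
proof (cases "i < length ts")
  case True
  have "list_all2 (typed L (\<Delta> @ \<Gamma>)) (rev ts) (rev \<tau>s)" using assms(1) by simp
  then have "typed L (\<Delta> @ \<Gamma>) (rev ts ! i) (rev \<tau>s ! i)"
    by (rule list_all2_nthD) (simp add: True)
  then show ?thesis using True list_all2_lengthD[OF assms(1)]
    by (simp add: inst_def nth_append)
next
  case False
  then show ?thesis using list_all2_lengthD[OF assms(1)] assms(2)
    by (auto simp: inst_def nth_append intro!: typed_Var')
qed

lemma wf_fm_plug:
  assumes "wf_fm L (rev \<tau>s @ \<Gamma>) A" "list_all2 (typed L (\<Delta> @ \<Gamma>)) ts \<tau>s" "k = length \<Delta>"
  shows "wf_fm L (\<Delta> @ \<Gamma>) (plug ts k A)"
  unfolding plug_def assms(3)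
  by (rule wf_fm_subst[OF assms(1)]) (rule typed_inst[OF assms(2)])

lemma typed_lift:
  assumes "typed L \<Gamma> t \<tau>" "k = length \<Delta>"
  shows "typed L (\<Delta> @ \<Gamma>) (lift k t) \<tau>"
  unfolding lift_def
  by (rule typed_tsubst[OF assms(1)]) (auto simp: inst_def nth_append assms(2) intro!: typed_Var')

lemma typed_tvars:
  assumes "length \<Delta> = k" "length \<tau>s = n"
  shows "list_all2 (typed L (\<Delta> @ rev \<tau>s @ \<Gamma>)) (tvars k n) \<tau>s"
  unfolding list_all2_conv_all_nth tvars_def
  using assms by (auto simp: rev_nth nth_append intro!: typed_Var')

lemma typed_apps:
  assumes "list_all2 (typed L \<Gamma>) ts \<rho>s" "typed L \<Gamma> t (arrs \<rho>s \<sigma>)"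
  shows "typed L \<Gamma> (apps t ts) \<sigma>"
  using assms
  by (induction arbitrary: t rule: list_all2_induct)
    (auto simp: apps_def arrs_def intro: typed_App)

lemma wf_fm_Foralls: "wf_fm L \<Gamma> (Foralls \<tau>s A) \<longleftrightarrow> wf_fm L (rev \<tau>s @ \<Gamma>) A"
  by (induction \<tau>s arbitrary: \<Gamma>) (auto simp: Foralls_def)

lemma wf_fm_Exs: "wf_fm L \<Gamma> (Exs \<tau>s A) \<longleftrightarrow> wf_fm L (rev \<tau>s @ \<Gamma>) A"
  by (induction \<tau>s arbitrary: \<Gamma>) (auto simp: Exs_def)

lemma wf_fm_HRm: "wf_fm L \<Gamma> A \<Longrightarrow> wf_fm L (rev (HRtys A) @ \<Gamma>) (HRm A)"
proof (induction A arbitrary: \<Gamma>)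
  case (Or A B)
  have "wf_fm L ((rev (HRtys B) @ rev (HRtys A)) @ \<Gamma>)
      (plug (tvars (length (HRtys B)) (length (HRtys A))) (length (HRtys A) + length (HRtys B)) (HRm A))"
    using Or by (intro wf_fm_plug[where \<tau>s = "HRtys A"]) (auto intro!: typed_tvars)
  moreover have "wf_fm L ((rev (HRtys B) @ rev (HRtys A)) @ \<Gamma>)
      (plug (tvars 0 (length (HRtys B))) (length (HRtys A) + length (HRtys B)) (HRm B))"
    using Or typed_tvars[of "[]" 0 "HRtys B" _ L "rev (HRtys A) @ \<Gamma>"]
    by (intro wf_fm_plug[where \<tau>s = "HRtys B"]) auto
  ultimately show ?case by (simp add: Let_def)
next
  case (And A B)
  have "wf_fm L ((rev (HRtys B) @ rev (HRtys A)) @ \<Gamma>)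
      (plug (tvars (length (HRtys B)) (length (HRtys A))) (length (HRtys A) + length (HRtys B)) (HRm A))"
    using And by (intro wf_fm_plug[where \<tau>s = "HRtys A"]) (auto intro!: typed_tvars)
  moreover have "wf_fm L ((rev (HRtys B) @ rev (HRtys A)) @ \<Gamma>)
      (plug (tvars 0 (length (HRtys B))) (length (HRtys A) + length (HRtys B)) (HRm B))"
    using And typed_tvars[of "[]" 0 "HRtys B" _ L "rev (HRtys A) @ \<Gamma>"]
    by (intro wf_fm_plug[where \<tau>s = "HRtys B"]) auto
  ultimately show ?case by (simp add: Let_def)
next
  case (Imp A B)
  let ?n = "length (HRtys A)" and ?m = "length (HRtys B)"
  let ?D = "rev (HRtys A) @ rev (HRtys (Imp A B))"
  have x: "list_all2 (typed L (?D @ \<Gamma>)) (tvars 0 ?n) (HRtys A)"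
    using typed_tvars[of "[]" 0 "HRtys A"] by auto
  have U: "list_all2 (typed L (?D @ \<Gamma>)) (tvars ?n ?m) (HRtys (Imp A B))"
    using typed_tvars[of "rev (HRtys A)" ?n "HRtys (Imp A B)" ?m] by auto
  have "list_all2 (typed L (?D @ \<Gamma>)) (map (\<lambda>V. apps V (tvars 0 ?n)) (tvars ?n ?m)) (HRtys B)"
    using U typed_apps[OF x] by (auto simp: list_all2_conv_all_nth)
  then have "wf_fm L (?D @ \<Gamma>)
      (plug (map (\<lambda>V. apps V (tvars 0 ?n)) (tvars ?n ?m)) (?n + ?m) (HRm B))"
    using Imp by (intro wf_fm_plug[where \<tau>s = "HRtys B"]) auto
  moreover have "wf_fm L (?D @ \<Gamma>) (plug (tvars 0 ?n) (?n + ?m) (HRm A))"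
    using Imp x by (intro wf_fm_plug[where \<tau>s = "HRtys A"]) auto
  ultimately show ?case by (simp add: Let_def wf_fm_Foralls)
next
  case (Forall \<tau> A)
  let ?n = "length (HRtys A)"
  let ?D = "\<tau> # rev (HRtys (Forall \<tau> A))"
  have X: "list_all2 (typed L (?D @ \<Gamma>)) (tvars 1 ?n) (HRtys (Forall \<tau> A))"
    using typed_tvars[of "[\<tau>]" 1 "HRtys (Forall \<tau> A)" ?n] by auto
  have z: "typed L (?D @ \<Gamma>) (Var 0) \<tau>" by (rule typed_Var') auto
  have "list_all2 (typed L (?D @ \<Gamma>)) (Var 0 # map (\<lambda>Y. Y \<cdot> Var 0) (tvars 1 ?n)) (\<tau> # HRtys A)"
    using X z by (auto simp: list_all2_conv_all_nth nth_Cons intro!: typed_App split: nat.splits)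
  then have "wf_fm L (?D @ \<Gamma>) (plug (Var 0 # map (\<lambda>Y. Y \<cdot> Var 0) (tvars 1 ?n)) (?n + 1) (HRm A))"
    using Forall by (intro wf_fm_plug[where \<tau>s = "\<tau> # HRtys A"]) auto
  then show ?case by (simp add: Let_def)
next
  case (Exists \<tau> A)
  let ?n = "length (HRtys A)"
  let ?D = "\<tau> # rev (HRtys (Exists \<tau> A))"
  have "list_all2 (typed L (?D @ \<Gamma>)) (Var 0 # tvars 1 ?n) (\<tau> # HRtys A)"
    using typed_tvars[of "[\<tau>]" 1 "HRtys A" ?n] by (auto intro: typed_Var')
  then have "wf_fm L (?D @ \<Gamma>) (plug (Var 0 # tvars 1 ?n) (?n + 2) (HRm A))"
    using Exists by (intro wf_fm_plug[where \<tau>s = "\<tau> # HRtys A"]) auto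
  then show ?case by (auto simp: Let_def nth_append intro!: typed_Var')
next
  case (BForall \<tau> t A)
  let ?n = "length (HRtys A)"
  let ?D = "\<tau> # rev (HRtys A)"
  have "list_all2 (typed L (?D @ \<Gamma>)) (Var 0 # tvars 1 ?n) (\<tau> # HRtys A)"
    using typed_tvars[of "[\<tau>]" 1 "HRtys A" ?n] by (auto intro: typed_Var')
  then have "wf_fm L (?D @ \<Gamma>) (plug (Var 0 # tvars 1 ?n) (?n + 1) (HRm A))"
    using BForall by (intro wf_fm_plug[where \<tau>s = "\<tau> # HRtys A"]) auto
  then show ?case using BForall.prems by (auto simp: Let_def intro!: typed_lift)
next
  case (BExists \<tau> t A)
  let ?n = "length (HRtys A)"
  let ?D = "\<tau> # rev (HRtys A)"
  have "list_all2 (typed L (?D @ \<Gamma>)) (Var 0 # tvars 1 ?n) (\<tau> # HRtys A)"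
    using typed_tvars[of "[\<tau>]" 1 "HRtys A" ?n] by (auto intro: typed_Var')
  then have "wf_fm L (?D @ \<Gamma>) (plug (Var 0 # tvars 1 ?n) (?n + 1) (HRm A))"
    using BExists by (intro wf_fm_plug[where \<tau>s = "\<tau> # HRtys A"]) auto
  then show ?case using BExists.prems by (auto simp: Let_def intro!: typed_lift)
qed auto

lemma wf_fm_HR: "wf_fm L \<Gamma> A \<Longrightarrow> wf_fm L \<Gamma> (HR A)"
  by (simp add: HR_def wf_fm_Exs wf_fm_HRm)

end

theory Submission
  imports Defs
begin

text \<open>The matrix is monotone in its realizers.  One proves, by induction on \<open>A\<close>, the stronger
  statement that for an arbitrary instance of the free variables of \<open>A\<close> and arbitrary terms
  \<open>a \<sqsubseteq> b\<close>, from hypotheses \<open>\<Phi>\<close> in any context, a derivation of \<open>A\<^sub>H\<^sub>R(a)\<close> yields one of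
  \<open>A\<^sub>H\<^sub>R(b)\<close>.  Implication needs the induction hypothesis only for its conclusion, since
  \<open>a \<sqsubseteq> b\<close> implies \<open>a x \<sqsubseteq> b x\<close> for the same \<open>x\<close>; an unbounded existential quantifier has become
  a quantifier bounded by a realizer, and enlarging the realizer preserves the witness.\<close>

section \<open>Calculus of substitutions\<close>

abbreviation shift :: "nat \<Rightarrow> 'f trm" where
  "shift i \<equiv> Var (Suc i)"

lemma tsubst_tsubst: "tsubst \<theta> (tsubst \<eta> t) = tsubst (\<lambda>i. tsubst \<theta> (\<eta> i)) t"
  by (induction t) auto

lemma tsubst_Var [simp]: "tsubst Var t = t"
  by (induction t) auto

lemma up_0 [simp]: "up \<theta> 0 = Var 0"
  by (simp add: up_def)

lemma up_Suc [simp]: "up \<theta> (Suc i) = tsubst shift (\<theta> i)"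
  by (simp add: up_def)

lemma up_Var [simp]: "up Var = Var"
  by (rule ext) (auto simp: up_def split: nat.split)

text \<open>At a successor both sides reduce to shifting the composite, because
  \<open>up \<theta>\<close> after a shift is a shift after \<open>\<theta>\<close>. This carries
  \<open>subst_subst\<close> under binders.\<close>

lemma up_comp: "up (\<lambda>i. tsubst \<theta> (\<eta> i)) = (\<lambda>i. tsubst (up \<theta>) (up \<eta> i))"
  by (rule ext) (auto simp: up_def tsubst_tsubst split: nat.split)

lemma subst_Var [simp]: "subst Var A = A"
  by (induction A) (auto simp: map_idI)

lemma subst_subst: "subst \<theta> (subst \<eta> A) = subst (\<lambda>i. tsubst \<theta> (\<eta> i)) A"
  by (induction A arbitrary: \<theta> \<eta>) (auto simp: tsubst_tsubst up_comp)

lemma lift_eq: "lift k = tsubst (\<lambda>i. Var (i + k))"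
  by (simp add: lift_def inst_def[abs_def])

lemma lift_1: "lift (Suc 0) = tsubst shift"
  by (simp add: lift_eq)

lemma plug_Nil: "plug [] k = subst (\<lambda>i. Var (i + k))"
  by (simp add: plug_def inst_def[abs_def])

lemma plug_Nil_1: "plug [] (Suc 0) = subst shift"
  by (simp add: plug_Nil)

text \<open>In the \<open>case_nat\<close> form the simplifier can evaluate the substitution at 0
  and at successors, which the rules for quantifiers call for.\<close>

lemma plug_single: "plug [t] 0 = subst (case_nat t Var)"
proof -
  have "inst [t] 0 = case_nat t Var"
    by (rule ext) (auto simp: inst_def split: nat.split)
  then show ?thesis by (simp add: plug_def)
qed

lemma tsubst_up_shift: "tsubst (up \<theta>) (tsubst shift t) = tsubst shift (tsubst \<theta> t)"
  by (simp add: tsubst_tsubst)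

lemma subst_up_shift: "subst (up \<theta>) (subst shift A) = subst shift (subst \<theta> A)"
  by (simp add: subst_subst)

lemma tsubst_case_nat_shift [simp]: "tsubst (case_nat t Var) (tsubst shift q) = q"
  by (simp add: tsubst_tsubst)

text \<open>The rules \<open>ForallE\<close> and \<open>ExistsI\<close> and the axiom
  \<open>eq_subst\<close> mention \<open>plug [t] 0 A\<close>; this equation lets a substitution
  pass through them.\<close>

lemma subst_plug_single: "subst \<theta> (plug [t] 0 A) = plug [tsubst \<theta> t] 0 (subst (up \<theta>) A)"
proof -
  have "(\<lambda>i. tsubst \<theta> (case_nat t Var i)) = (\<lambda>i. tsubst (case_nat (tsubst \<theta> t) Var) (up \<theta> i))"
    by (rule ext) (auto split: nat.split simp: up_def tsubst_tsubst)
  then show ?thesis by (simp add: plug_single subst_subst)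
qed

text \<open>Weakening below the binder sends \<open>Suc i\<close> to \<open>Suc (Suc i)\<close>;
  filling the binder with the fresh variable sends it back, and index 0 is fixed throughout. So
  instantiating a weakened quantifier at its eigenvariable recovers the body.\<close>

lemma plug_Var_0_up_shift:
  fixes A :: "('f, 'r) fm"
  shows "plug [Var 0] 0 (subst (up shift) A) = A"
proof -
  have "(\<lambda>i. tsubst (case_nat (Var 0) Var) (up shift i)) = (Var :: nat \<Rightarrow> 'f trm)"
    by (rule ext) (auto split: nat.split simp: up_def)
  then show ?thesis unfolding plug_single subst_subst by (simp only: subst_Var)
qed

section \<open>Derivations under substitution\<close>

definition typed_subst ::
  "('f, 'r) lang \<Rightarrow> ty list \<Rightarrow> (nat \<Rightarrow> 'f trm) \<Rightarrow> ty list \<Rightarrow> bool" where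
  "typed_subst L \<Delta> \<theta> \<Gamma> \<longleftrightarrow> (\<forall>i < length \<Gamma>. typed L \<Delta> (\<theta> i) (\<Gamma> ! i))"

lemma typed_tsubst_subst: "typed L \<Gamma> t \<tau> \<Longrightarrow> typed_subst L \<Delta> \<theta> \<Gamma> \<Longrightarrow> typed L \<Delta> (tsubst \<theta> t) \<tau>"
  by (erule typed_tsubst) (auto simp: typed_subst_def)

lemma wf_fm_typed_subst: "wf_fm L \<Gamma> A \<Longrightarrow> typed_subst L \<Delta> \<theta> \<Gamma> \<Longrightarrow> wf_fm L \<Delta> (subst \<theta> A)"
  by (erule wf_fm_subst) (auto simp: typed_subst_def)

lemma typed_subst_up: "typed_subst L \<Delta> \<theta> \<Gamma> \<Longrightarrow> typed_subst L (\<tau> # \<Delta>) (up \<theta>) (\<tau> # \<Gamma>)"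
  using typed_up[of \<Gamma> L \<Delta> \<theta>] unfolding typed_subst_def by blast

lemma typed_subst_shift: "typed_subst L (\<tau> # \<Gamma>) shift \<Gamma>"
  by (auto simp: typed_subst_def intro: typed_Var')

lemma typed_subst_Var: "typed_subst L \<Gamma> Var \<Gamma>"
  by (auto simp: typed_subst_def intro: typed_Var')

lemma typed_subst_weaken: "k = length \<Delta> \<Longrightarrow> typed_subst L (\<Delta> @ \<Gamma>) (\<lambda>i. Var (i + k)) \<Gamma>"
  by (auto simp: typed_subst_def nth_append intro!: typed_Var')

lemma typed_subst_comp:
  "typed_subst L \<Delta> \<theta> \<Gamma> \<Longrightarrow> typed_subst L \<Delta>' \<eta> \<Delta> \<Longrightarrow> typed_subst L \<Delta>' (\<lambda>i. tsubst \<eta> (\<theta> i)) \<Gamma>"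
  by (auto simp: typed_subst_def intro: typed_tsubst)

lemma atomic_subst: "atomic (subst \<theta> A) \<longleftrightarrow> atomic A"
  by (cases A) auto

text \<open>The axioms are schematic in their terms, so instances are axioms again. The cases
  written out are those where \<open>plug\<close>, a lifted bound or \<open>Iff\<close> has to be
  seen through.\<close>

lemma axm_subst: "axm A \<Longrightarrow> axm (subst \<theta> A)"
proof (induction rule: axm.induct)
  case (eq_subst A \<rho> x y)
  then show ?case by (simp add: subst_plug_single axm.eq_subst atomic_subst)
next
  case (bforall \<tau> t A)
  show ?case
    using axm.bforall[of \<tau> "tsubst \<theta> t" "subst (up \<theta>) A"]
    by (simp add: Iff_def lift_1 tsubst_up_shift)
next
  case (bexists \<tau> t A)
  show ?case
    using axm.bexists[of \<tau> "tsubst \<theta> t" "subst (up \<theta>) A"]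
    by (simp add: Iff_def lift_1 tsubst_up_shift)
next
  case (sing \<sigma> w x)
  show ?case using axm.sing[of \<sigma> "tsubst \<theta> w" "tsubst \<theta> x"] by (simp add: Iff_def)
next
  case (cup \<sigma> w x y)
  show ?case using axm.cup[of \<sigma> "tsubst \<theta> w" "tsubst \<theta> x" "tsubst \<theta> y"] by (simp add: Iff_def)
qed (auto intro: axm.intros)

text \<open>Allowing any superset \<open>\<Psi>\<close> of the substituted hypotheses makes
  weakening a special case and reduces discharged hypotheses to inclusions of sets. The substitution
  is arbitrary in the induction because the quantifier rules call for
  \<open>up \<theta>\<close>.\<close>

lemma proves_subst:
  assumes "proves L \<Gamma> \<Phi> A" "typed_subst L \<Delta> \<theta> \<Gamma>" "subst \<theta> ` \<Phi> \<subseteq> \<Psi>"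
  shows "proves L \<Delta> \<Psi> (subst \<theta> A)"
  using assms
proof (induction arbitrary: \<Delta> \<theta> \<Psi> rule: proves.induct)
  case (Ax A \<Gamma> \<Phi>)
  show ?case
    by (rule proves.Ax[OF axm_subst[OF Ax.hyps(1)] wf_fm_typed_subst[OF Ax.hyps(2) Ax.prems(1)]])
next
  case (Assm A \<Phi> \<Gamma>)
  then show ?case by (intro proves.Assm) (auto intro: wf_fm_typed_subst)
next
  case (BotE \<Gamma> \<Phi> A)
  show ?case
    using BotE.IH[OF BotE.prems] wf_fm_typed_subst[OF BotE.hyps(2) BotE.prems(1)]
    unfolding subst.simps by (rule proves.BotE)
next
  case (AndI \<Gamma> \<Phi> A B)
  show ?case unfolding subst.simps
    by (rule proves.AndI[OF AndI.IH(1)[OF AndI.prems] AndI.IH(2)[OF AndI.prems]])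
next
  case (AndE1 \<Gamma> \<Phi> A B)
  show ?case using AndE1.IH[OF AndE1.prems] unfolding subst.simps by (rule proves.AndE1)
next
  case (AndE2 \<Gamma> \<Phi> A B)
  show ?case using AndE2.IH[OF AndE2.prems] unfolding subst.simps by (rule proves.AndE2)
next
  case (OrI1 \<Gamma> \<Phi> A B)
  show ?case unfolding subst.simps
    by (rule proves.OrI1[OF OrI1.IH[OF OrI1.prems] wf_fm_typed_subst[OF OrI1.hyps(2) OrI1.prems(1)]])
next
  case (OrI2 \<Gamma> \<Phi> B A)
  show ?case unfolding subst.simps
    by (rule proves.OrI2[OF OrI2.IH[OF OrI2.prems] wf_fm_typed_subst[OF OrI2.hyps(2) OrI2.prems(1)]])
next
  case (OrE \<Gamma> \<Phi> A B C)
  have "proves L \<Delta> \<Psi> (Or (subst \<theta> A) (subst \<theta> B))"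
    using OrE.IH(1)[OF OrE.prems] by simp
  moreover have "proves L \<Delta> (insert (subst \<theta> A) \<Psi>) (subst \<theta> C)"
    using OrE.prems by (intro OrE.IH(2)) auto
  moreover have "proves L \<Delta> (insert (subst \<theta> B) \<Psi>) (subst \<theta> C)"
    using OrE.prems by (intro OrE.IH(3)) auto
  ultimately show ?case by (rule proves.OrE)
next
  case (ImpI \<Gamma> A \<Phi> B)
  have "proves L \<Delta> (insert (subst \<theta> A) \<Psi>) (subst \<theta> B)"
    using ImpI.prems by (intro ImpI.IH) auto
  then show ?case unfolding subst.simps
    by (rule proves.ImpI[OF _ wf_fm_typed_subst[OF ImpI.hyps(2) ImpI.prems(1)]])
next
  case (ImpE \<Gamma> \<Phi> A B)
  show ?case
    using ImpE.IH(1)[OF ImpE.prems] ImpE.IH(2)[OF ImpE.prems] unfolding subst.simps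
    by (rule proves.ImpE)
next
  case (ForallI \<tau> \<Gamma> \<Phi> A)
  \<comment> \<open>\<open>up \<theta>\<close> fixes the eigenvariable and sends a weakened
    hypothesis to the weakening of its instance.\<close>
  have "proves L (\<tau> # \<Delta>) (plug [] 1 ` \<Psi>) (subst (up \<theta>) A)"
    using ForallI.prems
    by (intro ForallI.IH typed_subst_up) (auto simp: plug_Nil_1 subst_up_shift)
  then show ?case unfolding subst.simps by (rule proves.ForallI)
next
  case (ForallE \<Gamma> \<Phi> \<tau> A t)
  show ?case
    using ForallE.IH[OF ForallE.prems] typed_tsubst_subst[OF ForallE.hyps(2) ForallE.prems(1)]
    unfolding subst.simps subst_plug_single by (rule proves.ForallE)
next
  case (ExistsI \<Gamma> \<Phi> t A \<tau>)
  have "proves L \<Delta> \<Psi> (plug [tsubst \<theta> t] 0 (subst (up \<theta>) A))"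
    using ExistsI.IH[OF ExistsI.prems] by (simp add: subst_plug_single)
  then show ?case unfolding subst.simps
    using typed_tsubst_subst[OF ExistsI.hyps(2) ExistsI.prems(1)]
      wf_fm_typed_subst[OF ExistsI.hyps(3) typed_subst_up[OF ExistsI.prems(1)]]
    by (rule proves.ExistsI)
next
  case (ExistsE \<Gamma> \<Phi> \<tau> A C)
  have "proves L \<Delta> \<Psi> (Exists \<tau> (subst (up \<theta>) A))"
    using ExistsE.IH(1)[OF ExistsE.prems] by simp
  moreover have "proves L (\<tau> # \<Delta>) (insert (subst (up \<theta>) A) (plug [] 1 ` \<Psi>))
      (subst (up \<theta>) (plug [] 1 C))"
    using ExistsE.prems
    by (intro ExistsE.IH(2) typed_subst_up) (auto simp: plug_Nil_1 subst_up_shift)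
  then have "proves L (\<tau> # \<Delta>) (insert (subst (up \<theta>) A) (plug [] 1 ` \<Psi>)) (plug [] 1 (subst \<theta> C))"
    by (simp add: plug_Nil_1 subst_up_shift)
  ultimately show ?case
    using wf_fm_typed_subst[OF ExistsE.hyps(3) ExistsE.prems(1)] by (rule proves.ExistsE)
qed

text \<open>The case of the identity substitution.\<close>

lemma proves_mono: "proves L \<Gamma> \<Phi> A \<Longrightarrow> \<Phi> \<subseteq> \<Psi> \<Longrightarrow> proves L \<Gamma> \<Psi> A"
  using proves_subst[of L \<Gamma> \<Phi> A \<Gamma> Var \<Psi>] by (simp add: typed_subst_Var)

lemma proves_shift: "proves L \<Gamma> \<Phi> A \<Longrightarrow> subst shift ` \<Phi> \<subseteq> \<Psi> \<Longrightarrow> proves L (\<tau> # \<Gamma>) \<Psi> (subst shift A)"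
  by (erule proves_subst[OF _ typed_subst_shift])

section \<open>Inversion and monotonicity of quantifiers in derivations\<close>

lemma proves_Forall_iff: "proves L \<Gamma> \<Phi> (Forall \<tau> A) \<longleftrightarrow> proves L (\<tau> # \<Gamma>) (plug [] 1 ` \<Phi>) A"
proof
  assume "proves L \<Gamma> \<Phi> (Forall \<tau> A)"
  \<comment> \<open>The converse of \<open>ForallI\<close>: weaken by a fresh variable, then
    instantiate with that variable.\<close>
  then have "proves L (\<tau> # \<Gamma>) (plug [] 1 ` \<Phi>) (subst shift (Forall \<tau> A))"
    by (rule proves_shift) (simp add: plug_Nil_1)
  then have "proves L (\<tau> # \<Gamma>) (plug [] 1 ` \<Phi>) (plug [Var 0] 0 (subst (up shift) A))"
    by (intro ForallE[where \<tau> = \<tau>]) (auto intro: typed_Var')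
  then show "proves L (\<tau> # \<Gamma>) (plug [] 1 ` \<Phi>) A" by (simp add: plug_Var_0_up_shift)
qed (rule ForallI)

lemma proves_Foralls_iff:
  "proves L \<Gamma> \<Phi> (Foralls \<tau>s A) \<longleftrightarrow> proves L (rev \<tau>s @ \<Gamma>) (plug [] (length \<tau>s) ` \<Phi>) A"
proof (induction \<tau>s arbitrary: \<Gamma> \<Phi>)
  case Nil
  then show ?case by (simp add: Foralls_def plug_Nil)
next
  case (Cons \<tau> \<tau>s)
  have "plug [] (length \<tau>s) ` plug [] 1 ` \<Phi> = plug [] (length (\<tau> # \<tau>s)) ` \<Phi>"
    by (simp add: plug_Nil image_image subst_subst)
  then show ?case
    using Cons[of "\<tau> # \<Gamma>" "plug [] 1 ` \<Phi>"] by (simp add: Foralls_def proves_Forall_iff)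
qed

text \<open>Every rule carries the well-formedness premises that its conclusion needs; only the
  instance in \<open>ForallE\<close> takes an argument. Typings can thus be read off from
  derivations later.\<close>

lemma wf_fm_proves: "proves L \<Gamma> \<Phi> A \<Longrightarrow> wf_fm L \<Gamma> A"
proof (induction rule: proves.induct)
  case (ForallE \<Gamma> \<Phi> \<tau> A t)
  then show ?case using wf_fm_plug[of L "[\<tau>]" \<Gamma> A "[]" "[t]" 0] by auto
qed auto

lemma proves_BForall_iff:
  assumes "typed L \<Gamma> t (Star \<tau>)"
  shows "proves L \<Gamma> \<Phi> (BForall \<tau> t A) \<longleftrightarrow>
    proves L \<Gamma> \<Phi> (Forall \<tau> (Imp (Mem \<tau> (Var 0) (lift 1 t)) A))" (is "?l \<longleftrightarrow> ?r")
proof -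
  have t: "typed L (\<tau> # \<Gamma>) (lift 1 t) (Star \<tau>)" "typed L (\<tau> # \<Gamma>) (Var 0) \<tau>"
    using typed_lift[OF assms, of 1 "[\<tau>]"] by (auto intro: typed_Var')
  \<comment> \<open>Whichever side is derivable, it shows that the body is well-formed, as
    \<open>Ax\<close> demands of the axiom.\<close>
  have "proves L \<Gamma> \<Phi> (Iff (BForall \<tau> t A) (Forall \<tau> (Imp (Mem \<tau> (Var 0) (lift 1 t)) A)))"
    if "?l \<or> ?r"
    using that wf_fm_proves[of L \<Gamma> \<Phi>] assms t
    by (intro Ax axm.bforall) (fastforce simp: Iff_def)
  then show ?thesis unfolding Iff_def by (meson AndE1 AndE2 ImpE)
qed

lemma proves_BExists_iff:
  assumes "typed L \<Gamma> t (Star \<tau>)"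
  shows "proves L \<Gamma> \<Phi> (BExists \<tau> t A) \<longleftrightarrow>
    proves L \<Gamma> \<Phi> (Exists \<tau> (And (Mem \<tau> (Var 0) (lift 1 t)) A))" (is "?l \<longleftrightarrow> ?r")
proof -
  have t: "typed L (\<tau> # \<Gamma>) (lift 1 t) (Star \<tau>)" "typed L (\<tau> # \<Gamma>) (Var 0) \<tau>"
    using typed_lift[OF assms, of 1 "[\<tau>]"] by (auto intro: typed_Var')
  have "proves L \<Gamma> \<Phi> (Iff (BExists \<tau> t A) (Exists \<tau> (And (Mem \<tau> (Var 0) (lift 1 t)) A)))"
    if "?l \<or> ?r"
    using that wf_fm_proves[of L \<Gamma> \<Phi>] assms t
    by (intro Ax axm.bexists) (fastforce simp: Iff_def)
  then show ?thesis unfolding Iff_def by (meson AndE1 AndE2 ImpE)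
qed

lemma proves_Exists_mono:
  assumes "proves L \<Gamma> \<Phi> (Exists \<tau> A)"
    and "proves L (\<tau> # \<Gamma>) (insert A (plug [] 1 ` \<Phi>)) B"
  shows "proves L \<Gamma> \<Phi> (Exists \<tau> B)"
proof (rule ExistsE[OF assms(1)])
  show "wf_fm L \<Gamma> (Exists \<tau> B)" using wf_fm_proves[OF assms(2)] by simp
  then have "wf_fm L (\<tau> # \<Gamma>) (subst shift (Exists \<tau> B))"
    by (rule wf_fm_typed_subst[OF _ typed_subst_shift])
  \<comment> \<open>The eigenvariable itself serves as the witness for the weakened
    conclusion.\<close>
  then have "proves L (\<tau> # \<Gamma>) (insert A (plug [] 1 ` \<Phi>)) (Exists \<tau> (subst (up shift) B))"
    using assms(2)
    by (intro ExistsI[where t = "Var 0"]) (auto simp: plug_Var_0_up_shift intro: typed_Var')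
  then show "proves L (\<tau> # \<Gamma>) (insert A (plug [] 1 ` \<Phi>)) (plug [] 1 (Exists \<tau> B))"
    by (simp add: plug_Nil_1)
qed

section \<open>Simultaneous assignments\<close>

text \<open>Generalizes \<open>inst\<close>, whose tail can only be a weakening: here
  \<open>\<theta>\<close> may instantiate the remaining free variables by any terms. The list is
  reversed since the last variable of a tuple is bound innermost.\<close>

definition assign :: "'f trm list \<Rightarrow> (nat \<Rightarrow> 'f trm) \<Rightarrow> nat \<Rightarrow> 'f trm" where
  "assign ts \<theta> i = (if i < length ts then rev ts ! i else \<theta> (i - length ts))"

text \<open>Later entries are innermost, so \<open>ts\<close> is consulted before
  \<open>us\<close>.\<close>

lemma assign_append: "assign (us @ ts) \<theta> = assign ts (assign us \<theta>)"
  by (auto simp: assign_def fun_eq_iff nth_append add.commute)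

lemma assign_Cons: "assign (t # ts) \<theta> = assign ts (assign [t] \<theta>)"
  using assign_append[of "[t]" ts] by simp

lemma inst_eq_assign: "inst ts k = assign ts (\<lambda>i. Var (i + k))"
  by (simp add: inst_def assign_def fun_eq_iff)

lemma tsubst_assign: "tsubst \<eta> (assign ts \<theta> i) = assign (map (tsubst \<eta>) ts) (\<lambda>i. tsubst \<eta> (\<theta> i)) i"
  by (simp add: assign_def rev_map)

lemma assign_ge: "k = length ts \<Longrightarrow> assign ts \<theta> (i + k) = \<theta> i"
  by (simp add: assign_def)

text \<open>The tail of \<open>inst xs k\<close> skips exactly the \<open>k\<close> terms of
  \<open>ts\<close> and lands in \<open>\<theta>\<close>. Hence an instance of a plugged matrix is
  again an assignment applied to the matrix itself, with the same treatment of the free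
  variables.\<close>

lemma subst_plug:
  "k = length ts \<Longrightarrow>
    subst (assign ts \<theta>) (plug xs k A) = subst (assign (map (tsubst (assign ts \<theta>)) xs) \<theta>) A"
  by (simp add: plug_def subst_subst inst_eq_assign tsubst_assign assign_ge)

lemma length_tvars [simp]: "length (tvars k n) = n"
  by (simp add: tvars_def)

text \<open>The block \<open>ts\<close> is innermost, so a tuple with \<open>k\<close> further
  variables bound after it denotes the block just before \<open>ts\<close>.\<close>

lemma map_tsubst_tvars:
  "k = length ts \<Longrightarrow> n = length us \<Longrightarrow> map (tsubst (assign (vs @ us @ ts) \<theta>)) (tvars k n) = us"
  by (rule nth_equalityI) (auto simp: tvars_def assign_def nth_append rev_nth)

lemma tsubst_lift_assign: "k = length ts \<Longrightarrow> tsubst (assign ts \<theta>) (lift k t) = tsubst \<theta> t"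
  by (simp add: lift_eq tsubst_tsubst assign_ge)

text \<open>Assignments are closed under passing below binders: the old terms are lifted and the new
  variables, being innermost, come last.\<close>

lemma funpow_up:
  fixes \<theta> :: "nat \<Rightarrow> 'f trm"
  shows "(up ^^ n) (assign ts \<theta>) = assign (map (lift n) ts @ tvars 0 n) (\<lambda>i. lift n (\<theta> i))"
proof (induction n)
  case 0
  then show ?case by (simp add: tvars_def lift_eq)
next
  case (Suc n)
  have "tsubst shift (lift n t) = lift (Suc n) t" for t :: "'f trm"
    by (simp add: lift_eq tsubst_tsubst)
  moreover have "map (tsubst shift) (tvars 0 n) @ [Var 0] = (tvars 0 (Suc n) :: 'f trm list)"
    by (rule nth_equalityI) (auto simp: tvars_def nth_append rev_nth nth_Cons split: nat.split)
  moreover have "up (assign us \<eta>) = assign (map (tsubst shift) us @ [Var 0]) (\<lambda>i. tsubst shift (\<eta> i))"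
    for us and \<eta> :: "nat \<Rightarrow> 'f trm"
    by (auto simp: fun_eq_iff up_def assign_def nth_append rev_map split: nat.split)
  ultimately show ?case by (simp add: Suc comp_def)
qed

lemma up_assign: "up (assign ts \<theta>) = assign (map (lift 1) ts @ [Var 0]) (\<lambda>i. lift 1 (\<theta> i))"
  using funpow_up[of 1 ts \<theta>] by (simp add: tvars_def)

lemma subst_Foralls: "subst \<theta> (Foralls \<tau>s A) = Foralls \<tau>s (subst ((up ^^ length \<tau>s) \<theta>) A)"
  by (induction \<tau>s arbitrary: \<theta>) (auto simp: Foralls_def funpow_swap1)

lemma tsubst_apps: "tsubst \<theta> (apps t ts) = apps (tsubst \<theta> t) (map (tsubst \<theta>) ts)"
  by (induction ts arbitrary: t) (auto simp: apps_def)

lemma typed_subst_assign: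
  assumes "list_all2 (typed L \<Delta>) ts \<tau>s" "typed_subst L \<Delta> \<theta> \<Gamma>"
  shows "typed_subst L \<Delta> (assign ts \<theta>) (rev \<tau>s @ \<Gamma>)"
proof -
  have "list_all2 (typed L \<Delta>) (rev ts) (rev \<tau>s)" using assms(1) by simp
  then have "typed L \<Delta> (rev ts ! i) (rev \<tau>s ! i)" if "i < length ts" for i
    using that by (intro list_all2_nthD[of "typed L \<Delta>"]) simp_all
  then show ?thesis using assms(2) list_all2_lengthD[OF assms(1)]
    by (auto simp: typed_subst_def assign_def nth_append)
qed

section \<open>Monotonicity of the matrix\<close>

lemma subst_sqsub: "subst \<theta> (sqsub \<sigma> a b) = sqsub \<sigma> (tsubst \<theta> a) (tsubst \<theta> b)"
  by (induction \<sigma> arbitrary: \<theta> a b) (auto simp: lift_1 tsubst_up_shift)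

lemma proves_sqsub_App:
  assumes "proves L \<Gamma> \<Phi> (sqsub (\<rho> \<rightarrow> \<sigma>) a b)" "typed L \<Gamma> t \<rho>"
  shows "proves L \<Gamma> \<Phi> (sqsub \<sigma> (a \<cdot> t) (b \<cdot> t))"
  using ForallE[OF assms(1)[unfolded sqsub.simps] assms(2)]
  by (simp add: plug_single subst_sqsub lift_1)

lemma proves_sqsub_Mem:
  assumes "proves L \<Gamma> \<Phi> (sqsub (Star \<tau>) a b)" "proves L \<Gamma> \<Phi> (Mem \<tau> t a)"
  shows "proves L \<Gamma> \<Phi> (Mem \<tau> t b)"
proof -
  have "typed L \<Gamma> t \<tau>" using wf_fm_proves[OF assms(2)] by simp
  from ForallE[OF assms(1)[unfolded sqsub.simps] this]
  have "proves L \<Gamma> \<Phi> (Imp (Mem \<tau> t a) (Mem \<tau> t b))" by (simp add: plug_single lift_1)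
  then show ?thesis using assms(2) by (rule ImpE)
qed

lemma proves_sqsub_apps:
  assumes "list_all2 (typed L \<Gamma>) ts \<rho>s" "proves L \<Gamma> \<Phi> (sqsub (arrs \<rho>s \<sigma>) a b)"
  shows "proves L \<Gamma> \<Phi> (sqsub \<sigma> (apps a ts) (apps b ts))"
  using assms
  by (induction arbitrary: a b rule: list_all2_induct)
    (auto simp: apps_def arrs_def simp del: sqsub.simps intro: proves_sqsub_App)

text \<open>Keeping the two tuples zipped lets the library of \<open>list_all2\<close> split and map them together.\<close>

definition sq_pair ::
  "('f, 'r) lang \<Rightarrow> ty list \<Rightarrow> ('f, 'r) fm set \<Rightarrow> 'f trm \<times> 'f trm \<Rightarrow> ty \<Rightarrow> bool" where
  "sq_pair L \<Delta> \<Phi> p \<sigma> \<longleftrightarrow> typed L \<Delta> (fst p) \<sigma> \<and> typed L \<Delta> (snd p) \<sigma> \<and>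
    proves L \<Delta> \<Phi> (sqsub \<sigma> (fst p) (snd p))"

lemma sq_pair_typed:
  assumes "list_all2 (sq_pair L \<Delta> \<Phi>) ps \<sigma>s"
  shows "list_all2 (typed L \<Delta>) (map fst ps) \<sigma>s" "list_all2 (typed L \<Delta>) (map snd ps) \<sigma>s"
  using assms by (auto simp: list_all2_conv_all_nth sq_pair_def)

lemma sq_pairs_subst:
  assumes "list_all2 (sq_pair L \<Delta> \<Phi>) ps \<sigma>s" "typed_subst L \<Delta>' \<eta> \<Delta>" "subst \<eta> ` \<Phi> \<subseteq> \<Psi>"
  shows "list_all2 (sq_pair L \<Delta>' \<Psi>) (map (map_prod (tsubst \<eta>) (tsubst \<eta>)) ps) \<sigma>s"
  using assms
  by (auto simp: list_all2_conv_all_nth sq_pair_def subst_sqsub[symmetric]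
      intro: typed_tsubst_subst proves_subst)

lemma sq_pairs_mono:
  "list_all2 (sq_pair L \<Delta> \<Phi>) ps \<sigma>s \<Longrightarrow> \<Phi> \<subseteq> \<Psi> \<Longrightarrow> list_all2 (sq_pair L \<Delta> \<Psi>) ps \<sigma>s"
  by (erule list_all2_mono) (auto simp: sq_pair_def intro: proves_mono)

lemma sq_pairs_lift:
  assumes "list_all2 (sq_pair L \<Delta> \<Phi>) ps \<sigma>s" "k = length \<Delta>'" "plug [] k ` \<Phi> \<subseteq> \<Psi>"
  shows "list_all2 (sq_pair L (\<Delta>' @ \<Delta>) \<Psi>) (map (map_prod (lift k) (lift k)) ps) \<sigma>s"
  unfolding lift_eq
  using assms by (intro sq_pairs_subst[OF assms(1) typed_subst_weaken]) (auto simp: plug_Nil)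

lemma typed_subst_lift:
  "typed_subst L \<Delta> \<theta> \<Gamma> \<Longrightarrow> k = length \<Delta>' \<Longrightarrow> typed_subst L (\<Delta>' @ \<Delta>) (\<lambda>i. lift k (\<theta> i)) \<Gamma>"
  unfolding lift_eq by (erule typed_subst_comp) (rule typed_subst_weaken)

section \<open>Instances of the matrices of compound formulas\<close>

lemma wf_fm_subst_HRm:
  assumes "wf_fm L \<Gamma> A" "typed_subst L \<Delta> \<theta> \<Gamma>" "list_all2 (typed L \<Delta>) ts (HRtys A)"
  shows "wf_fm L \<Delta> (subst (assign ts \<theta>) (HRm A))"
  by (rule wf_fm_typed_subst[OF wf_fm_HRm[OF assms(1)] typed_subst_assign[OF assms(3,2)]])

text \<open>Serves both \<open>Or\<close> and \<open>And\<close>: the first component of the matrix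
  reads only \<open>us\<close>, the second only \<open>ts\<close>.\<close>

lemma subst_HRm_append:
  assumes "length us = length (HRtys A)" "length ts = length (HRtys B)"
  shows "subst (assign (us @ ts) \<theta>)
      (plug (tvars (length (HRtys B)) (length (HRtys A))) (length (HRtys A) + length (HRtys B)) C)
      = subst (assign us \<theta>) C"
    and "subst (assign (us @ ts) \<theta>)
      (plug (tvars 0 (length (HRtys B))) (length (HRtys A) + length (HRtys B)) C)
      = subst (assign ts \<theta>) C"
  using map_tsubst_tvars[of "length ts" ts "length us" us "[]" \<theta>]
    map_tsubst_tvars[of 0 "[]" "length ts" ts us \<theta>] assms
  by (simp_all add: subst_plug)

text \<open>The premise reads only the tuple bound by the quantifiers and is independent of
  \<open>ts\<close>; the realizers enter through the conclusion alone, applied to that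
  tuple.\<close>

lemma subst_HRm_Imp:
  assumes "length ts = length (HRtys B)"
  shows "subst (assign ts \<theta>) (HRm (Imp A B)) = Foralls (HRtys A)
    (Imp (subst (assign (tvars 0 (length (HRtys A))) (\<lambda>i. lift (length (HRtys A)) (\<theta> i))) (HRm A))
      (subst (assign (map (\<lambda>t. apps (lift (length (HRtys A)) t) (tvars 0 (length (HRtys A)))) ts)
         (\<lambda>i. lift (length (HRtys A)) (\<theta> i))) (HRm B)))"
proof -
  let ?n = "length (HRtys A)"
  let ?us = "map (lift ?n) ts"
  let ?\<eta> = "assign (?us @ tvars 0 ?n) (\<lambda>i. lift ?n (\<theta> i))"
  have x: "map (tsubst ?\<eta>) (tvars 0 ?n) = tvars 0 ?n"
    using map_tsubst_tvars[of 0 "[]" ?n "tvars 0 ?n" ?us] by simp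
  have "map (tsubst ?\<eta>) (tvars ?n (length (HRtys B))) = ?us"
    using map_tsubst_tvars[of ?n "tvars 0 ?n" _ ?us "[]"] assms by simp
  then have U: "map (\<lambda>V. apps V (tvars 0 ?n)) (map (tsubst ?\<eta>) (tvars ?n (length (HRtys B))))
      = map (\<lambda>V. apps V (tvars 0 ?n)) ?us" by (rule arg_cong)
  have "map (tsubst ?\<eta>) (map (\<lambda>V. apps V (tvars 0 ?n)) (tvars ?n (length (HRtys B))))
      = map (\<lambda>V. apps V (tvars 0 ?n)) ?us"
    unfolding U[symmetric] by (simp add: tsubst_apps x)
  then show ?thesis
    using assms x by (simp add: Let_def subst_Foralls funpow_up subst_plug comp_def)
qed

text \<open>Shared by \<open>Exists\<close> and the bounded quantifiers. The block \<open>vs\<close>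
  holds the lifted bound in the case of \<open>Exists\<close> and is empty otherwise. In the
  compound matrix \<open>z\<close> is bound innermost, but in \<open>HRm A\<close> it lies outside
  the tuple of realizers, hence the change of order.\<close>

lemma subst_HRm_body:
  assumes "length ts = n" "k = length vs + n + 1"
  shows "subst (assign (vs @ ts @ [z]) \<theta>) (plug (Var 0 # tvars 1 n) k C)
    = subst (assign ts (assign [z] \<theta>)) C"
proof -
  have "map (tsubst (assign (vs @ ts @ [z]) \<theta>)) (tvars 1 n) = ts"
    by (rule map_tsubst_tvars) (use assms in auto)
  moreover have "tsubst (assign (vs @ ts @ [z]) \<theta>) (Var 0) = z"
    by (simp add: assign_def)
  ultimately show ?thesis using assms
    by (subst subst_plug) (simp_all add: assign_Cons[of z ts] del: tsubst.simps)
qed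

lemma subst_HRm_Forall:
  assumes "length ts = length (HRtys A)"
  shows "subst (assign ts \<theta>) (HRm (Forall \<tau> A)) = Forall \<tau>
    (subst (assign (map (\<lambda>t. lift 1 t \<cdot> Var 0) ts) (assign [Var 0] (\<lambda>i. lift 1 (\<theta> i)))) (HRm A))"
proof -
  let ?us = "map (lift 1) ts"
  let ?\<eta> = "assign (?us @ [Var 0]) (\<lambda>i. lift 1 (\<theta> i))"
  have "map (tsubst ?\<eta>) (tvars 1 (length (HRtys A))) = ?us"
    using map_tsubst_tvars[of 1 "[Var 0]" _ ?us "[]"] assms by simp
  then have "map (\<lambda>t. t \<cdot> Var 0) (map (tsubst ?\<eta>) (tvars 1 (length (HRtys A))))
      = map (\<lambda>t. lift 1 t \<cdot> Var 0) ts" by simp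
  moreover have z: "?\<eta> 0 = Var 0" by (simp add: assign_def)
  ultimately have "map (tsubst ?\<eta>) (Var 0 # map (\<lambda>Y. Y \<cdot> Var 0) (tvars 1 (length (HRtys A))))
      = Var 0 # map (\<lambda>t. lift 1 t \<cdot> Var 0) ts" by (simp add: comp_def)
  then have "subst ?\<eta> (plug (Var 0 # map (\<lambda>Y. Y \<cdot> Var 0) (tvars 1 (length (HRtys A))))
        (length (HRtys A) + 1) (HRm A))
      = subst (assign (Var 0 # map (\<lambda>t. lift 1 t \<cdot> Var 0) ts) (\<lambda>i. lift 1 (\<theta> i))) (HRm A)"
    using assms by (subst subst_plug) simp_all
  then show ?thesis
    unfolding assign_Cons[of "Var 0" "map (\<lambda>t. lift 1 t \<cdot> Var 0) ts"]
    by (simp add: Let_def up_assign)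
qed

lemma subst_HRm_Exists:
  assumes "length ts = length (HRtys A)"
  shows "subst (assign (Z # ts) \<theta>) (HRm (Exists \<tau> A)) = BExists \<tau> Z
    (subst (assign (map (lift 1) ts) (assign [Var 0] (\<lambda>i. lift 1 (\<theta> i)))) (HRm A))"
  using assms subst_HRm_body[of "map (lift 1) ts" "length (HRtys A)" "length (HRtys A) + 2"
      "[lift 1 Z]" "Var 0" "\<lambda>i. lift 1 (\<theta> i)" "HRm A"]
  by (simp add: Let_def up_assign assign_def[of _ _ "length (HRtys A)"] nth_append)

lemma subst_HRm_BForall:
  assumes "length ts = length (HRtys A)"
  shows "subst (assign ts \<theta>) (HRm (BForall \<tau> t A)) = BForall \<tau> (tsubst \<theta> t)
    (subst (assign (map (lift 1) ts) (assign [Var 0] (\<lambda>i. lift 1 (\<theta> i)))) (HRm A))"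
  using assms subst_HRm_body[of "map (lift 1) ts" "length (HRtys A)" "length (HRtys A) + 1"
      "[]" "Var 0" "\<lambda>i. lift 1 (\<theta> i)" "HRm A"]
  by (simp add: Let_def up_assign tsubst_lift_assign)

lemma subst_HRm_BExists:
  assumes "length ts = length (HRtys A)"
  shows "subst (assign ts \<theta>) (HRm (BExists \<tau> t A)) = BExists \<tau> (tsubst \<theta> t)
    (subst (assign (map (lift 1) ts) (assign [Var 0] (\<lambda>i. lift 1 (\<theta> i)))) (HRm A))"
  using assms subst_HRm_body[of "map (lift 1) ts" "length (HRtys A)" "length (HRtys A) + 1"
      "[]" "Var 0" "\<lambda>i. lift 1 (\<theta> i)" "HRm A"]
  by (simp add: Let_def up_assign tsubst_lift_assign)

lemma typed_subst_lift_assign: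
  assumes "typed_subst L \<Delta> \<theta> \<Gamma>"
  shows "typed_subst L (\<tau> # \<Delta>) (assign [Var 0] (\<lambda>i. lift 1 (\<theta> i))) (\<tau> # \<Gamma>)"
  using typed_subst_assign[of L "\<tau> # \<Delta>" "[Var 0]" "[\<tau>]" "\<lambda>i. lift 1 (\<theta> i)" \<Gamma>]
    typed_subst_lift[OF assms, of 1 "[\<tau>]"]
  by (simp add: typed_Var')

text \<open>Realizers are terms because implication uses the induction hypothesis at
  \<open>U x\<close> and universal quantification at \<open>X z\<close>. The assignment
  \<open>\<theta>\<close> absorbs the variable of a quantifier when the body is treated over a
  longer context.\<close>

lemma proves_HRm_mono:
  assumes "wf_fm L \<Gamma> A" "typed_subst L \<Delta> \<theta> \<Gamma>" "list_all2 (sq_pair L \<Delta> \<Phi>) ps (HRtys A)"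
    and "proves L \<Delta> \<Phi> (subst (assign (map fst ps) \<theta>) (HRm A))"
  shows "proves L \<Delta> \<Phi> (subst (assign (map snd ps) \<theta>) (HRm A))"
  using assms
proof (induction A arbitrary: \<Gamma> \<Delta> \<theta> \<Phi> ps)
  case (Or A B)
  from Or.prems(3) obtain ps1 ps2 where ps: "ps = ps1 @ ps2"
    and sq: "list_all2 (sq_pair L \<Delta> \<Phi>) ps1 (HRtys A)" "list_all2 (sq_pair L \<Delta> \<Phi>) ps2 (HRtys B)"
    by (auto simp: list_all2_append2)
  note len = sq[THEN list_all2_lengthD]
  \<comment> \<open>The parameter is \<open>fst\<close> for the smaller realizers and
    \<open>snd\<close> for the larger ones.\<close>
  let ?A = "\<lambda>f. subst (assign (map f ps1) \<theta>) (HRm A)"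
  let ?B = "\<lambda>f. subst (assign (map f ps2) \<theta>) (HRm B)"
  have eq: "subst (assign (map f ps) \<theta>) (HRm (Or A B)) = Or (?A f) (?B f)" for f
    using len by (simp add: Let_def ps subst_HRm_append)
  have wf: "wf_fm L \<Delta> (?A fst)" "wf_fm L \<Delta> (?B fst)" "wf_fm L \<Delta> (?A snd)" "wf_fm L \<Delta> (?B snd)"
    using Or.prems(1,2) sq by (auto intro: wf_fm_subst_HRm sq_pair_typed)
  have "proves L \<Delta> (insert (?A fst) \<Phi>) (?A snd)"
    using Or.prems(1,2) wf(1) sq_pairs_mono[OF sq(1)]
    by (intro Or.IH(1)[of \<Gamma>]) (simp_all add: Assm subset_insertI)
  then have 1: "proves L \<Delta> (insert (?A fst) \<Phi>) (Or (?A snd) (?B snd))" using wf(4) by (rule OrI1)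
  have "proves L \<Delta> (insert (?B fst) \<Phi>) (?B snd)"
    using Or.prems(1,2) wf(2) sq_pairs_mono[OF sq(2)]
    by (intro Or.IH(2)[of \<Gamma>]) (simp_all add: Assm subset_insertI)
  then have 2: "proves L \<Delta> (insert (?B fst) \<Phi>) (Or (?A snd) (?B snd))" using wf(3) by (rule OrI2)
  show ?case using Or.prems(4) 1 2 unfolding eq by (rule OrE)
next
  case (And A B)
  from And.prems(3) obtain ps1 ps2 where ps: "ps = ps1 @ ps2"
    and sq: "list_all2 (sq_pair L \<Delta> \<Phi>) ps1 (HRtys A)" "list_all2 (sq_pair L \<Delta> \<Phi>) ps2 (HRtys B)"
    by (auto simp: list_all2_append2)
  note len = sq[THEN list_all2_lengthD]
  have eq: "subst (assign (map f ps) \<theta>) (HRm (And A B)) =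
      And (subst (assign (map f ps1) \<theta>) (HRm A)) (subst (assign (map f ps2) \<theta>) (HRm B))" for f
    using len by (simp add: Let_def ps subst_HRm_append)
  show ?case
    using And.prems(1,2) sq And.prems(4)[unfolded eq, THEN AndE1]
      And.prems(4)[unfolded eq, THEN AndE2]
    unfolding eq by (intro AndI And.IH) auto
next
  case (Imp A B)
  let ?n = "length (HRtys A)"
  let ?\<Delta> = "rev (HRtys A) @ \<Delta>"
  let ?\<theta> = "\<lambda>i. lift ?n (\<theta> i)"
  let ?x = "tvars 0 ?n"
  let ?qs = "map (map_prod (\<lambda>t. apps (lift ?n t) ?x) (\<lambda>t. apps (lift ?n t) ?x)) ps"
  let ?A = "subst (assign ?x ?\<theta>) (HRm A)"
  let ?B = "\<lambda>f. subst (assign (map f ?qs) ?\<theta>) (HRm B)"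
  let ?\<Psi> = "insert ?A (plug [] ?n ` \<Phi>)"
  have len: "length ps = length (HRtys B)" using list_all2_lengthD[OF Imp.prems(3)] by simp
  have eq: "subst (assign (map fst ps) \<theta>) (HRm (Imp A B)) = Foralls (HRtys A) (Imp ?A (?B fst))"
    "subst (assign (map snd ps) \<theta>) (HRm (Imp A B)) = Foralls (HRtys A) (Imp ?A (?B snd))"
    using len by (simp_all add: subst_HRm_Imp comp_def del: HRm.simps)
  have x: "list_all2 (typed L ?\<Delta>) ?x (HRtys A)"
    using typed_tvars[of "[]" 0 "HRtys A"] by auto
  have \<theta>: "typed_subst L ?\<Delta> ?\<theta> \<Gamma>"
    using Imp.prems(2) by (rule typed_subst_lift) simp
  have wf: "wf_fm L ?\<Delta> ?A"
    using Imp.prems(1) \<theta> x by (auto intro: wf_fm_subst_HRm)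
  have "list_all2 (sq_pair L ?\<Delta> ?\<Psi>) (map (map_prod (lift ?n) (lift ?n)) ps) (HRtys (Imp A B))"
    using Imp.prems(3) by (rule sq_pairs_lift) auto
  \<comment> \<open>Both members of each lifted pair are applied to the same generic tuple, so
    inclusion at the function type gives inclusion of the values.\<close>
  then have sq: "list_all2 (sq_pair L ?\<Delta> ?\<Psi>) ?qs (HRtys B)"
    by (auto simp: list_all2_conv_all_nth[of "sq_pair L ?\<Delta> ?\<Psi>"] sq_pair_def
        intro!: typed_apps[OF x] proves_sqsub_apps[OF x])
  have "proves L ?\<Delta> (plug [] ?n ` \<Phi>) (Imp ?A (?B fst))"
    using Imp.prems(4) unfolding eq proves_Foralls_iff .
  then have "proves L ?\<Delta> ?\<Psi> (Imp ?A (?B fst))" by (rule proves_mono) auto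
  \<comment> \<open>\<open>?A\<close> is a hypothesis in \<open>?\<Psi>\<close> and is the premise
    of both implications, so no monotonicity of \<open>HRm A\<close> enters.\<close>
  then have "proves L ?\<Delta> ?\<Psi> (?B fst)" by (rule ImpE) (simp add: Assm wf)
  then have "proves L ?\<Delta> ?\<Psi> (?B snd)" using Imp.prems(1) \<theta> sq by (intro Imp.IH(2)) auto
  then show ?case unfolding eq proves_Foralls_iff using wf by (rule ImpI)
next
  case (Forall \<tau> A)
  let ?\<theta> = "assign [Var 0] (\<lambda>i. lift 1 (\<theta> i))"
  let ?qs = "map (map_prod (\<lambda>t. lift 1 t \<cdot> Var 0) (\<lambda>t. lift 1 t \<cdot> Var 0)) ps"
  let ?A = "\<lambda>f. subst (assign (map f ?qs) ?\<theta>) (HRm A)"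
  let ?\<Psi> = "plug [] 1 ` \<Phi>"
  have len: "length ps = length (HRtys A)" using list_all2_lengthD[OF Forall.prems(3)] by simp
  have eq: "subst (assign (map fst ps) \<theta>) (HRm (Forall \<tau> A)) = Forall \<tau> (?A fst)"
    "subst (assign (map snd ps) \<theta>) (HRm (Forall \<tau> A)) = Forall \<tau> (?A snd)"
    using len by (simp_all add: subst_HRm_Forall comp_def del: HRm.simps)
  have z: "typed L (\<tau> # \<Delta>) (Var 0) \<tau>" by (rule typed_Var') auto
  have "list_all2 (sq_pair L ([\<tau>] @ \<Delta>) ?\<Psi>) (map (map_prod (lift 1) (lift 1)) ps)
      (HRtys (Forall \<tau> A))"
    using Forall.prems(3) by (rule sq_pairs_lift) auto
  then have sq: "list_all2 (sq_pair L (\<tau> # \<Delta>) ?\<Psi>) ?qs (HRtys A)"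
    by (auto simp: list_all2_conv_all_nth sq_pair_def simp del: sqsub.simps
        intro!: typed_App[OF _ z] proves_sqsub_App[OF _ z])
  show ?case
    using Forall.prems(1,4) sq unfolding eq proves_Forall_iff
    by (intro Forall.IH[OF _ typed_subst_lift_assign[OF Forall.prems(2)]]) auto
next
  case (Exists \<tau> A)
  from Exists.prems(3) obtain p qs where ps: "ps = p # qs" and p: "sq_pair L \<Delta> \<Phi> p (Star \<tau>)"
    and qs: "list_all2 (sq_pair L \<Delta> \<Phi>) qs (HRtys A)"
    by (auto simp: list_all2_Cons2)
  let ?\<theta> = "assign [Var 0] (\<lambda>i. lift 1 (\<theta> i))"
  let ?qs = "map (map_prod (lift 1) (lift 1)) qs"
  let ?A = "\<lambda>f. subst (assign (map f ?qs) ?\<theta>) (HRm A)"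
  let ?M = "\<lambda>f. Mem \<tau> (Var 0) (lift 1 (f p))"
  let ?\<Psi> = "insert (And (?M fst) (?A fst)) (plug [] 1 ` \<Phi>)"
  have eq: "subst (assign (map fst ps) \<theta>) (HRm (Exists \<tau> A)) = BExists \<tau> (fst p) (?A fst)"
    "subst (assign (map snd ps) \<theta>) (HRm (Exists \<tau> A)) = BExists \<tau> (snd p) (?A snd)"
    using list_all2_lengthD[OF qs] by (simp_all add: ps subst_HRm_Exists comp_def del: HRm.simps)
  have Z: "typed L \<Delta> (fst p) (Star \<tau>)" "typed L \<Delta> (snd p) (Star \<tau>)"
    using p by (auto simp: sq_pair_def)
  have ex: "proves L \<Delta> \<Phi> (Exists \<tau> (And (?M fst) (?A fst)))"
    using Exists.prems(4) unfolding eq proves_BExists_iff[OF Z(1)] .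
  have "wf_fm L (\<tau> # \<Delta>) (And (?M fst) (?A fst))" using wf_fm_proves[OF ex] by simp
  then have hyp: "proves L (\<tau> # \<Delta>) ?\<Psi> (And (?M fst) (?A fst))" by (intro Assm) simp_all
  have "list_all2 (sq_pair L ([\<tau>] @ \<Delta>) ?\<Psi>) (map (map_prod (lift 1) (lift 1)) ps)
      (HRtys (Exists \<tau> A))"
    using Exists.prems(3) by (rule sq_pairs_lift) auto
  \<comment> \<open>The tail of the lifted pairs feeds the induction hypothesis; the head is the
    inclusion of the two bounds, which will move the membership of the eigenvariable.\<close>
  then have sq: "list_all2 (sq_pair L (\<tau> # \<Delta>) ?\<Psi>) ?qs (HRtys A)"
    and Zsq: "proves L (\<tau> # \<Delta>) ?\<Psi> (sqsub (Star \<tau>) (lift 1 (fst p)) (lift 1 (snd p)))"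
    by (auto simp: ps sq_pair_def simp del: sqsub.simps)
  have "proves L (\<tau> # \<Delta>) ?\<Psi> (?A snd)"
    using Exists.prems(1) sq AndE2[OF hyp]
    by (intro Exists.IH[OF _ typed_subst_lift_assign[OF Exists.prems(2)]]) auto
  then show ?case
    unfolding eq proves_BExists_iff[OF Z(2)]
    by (intro proves_Exists_mono[OF ex] AndI proves_sqsub_Mem[OF Zsq AndE1[OF hyp]])
next
  case (BForall \<tau> t A)
  let ?\<theta> = "assign [Var 0] (\<lambda>i. lift 1 (\<theta> i))"
  let ?qs = "map (map_prod (lift 1) (lift 1)) ps"
  let ?A = "\<lambda>f. subst (assign (map f ?qs) ?\<theta>) (HRm A)"
  \<comment> \<open>The bound is a term of the formula and not a realizer, so the same membership
    guards both matrices.\<close>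
  let ?M = "Mem \<tau> (Var 0) (lift 1 (tsubst \<theta> t))"
  let ?\<Psi> = "insert ?M (plug [] 1 ` \<Phi>)"
  have len: "length ps = length (HRtys A)" using list_all2_lengthD[OF BForall.prems(3)] by simp
  have eq: "subst (assign (map fst ps) \<theta>) (HRm (BForall \<tau> t A)) = BForall \<tau> (tsubst \<theta> t) (?A fst)"
    "subst (assign (map snd ps) \<theta>) (HRm (BForall \<tau> t A)) = BForall \<tau> (tsubst \<theta> t) (?A snd)"
    using len by (simp_all add: subst_HRm_BForall comp_def del: HRm.simps)
  have t: "typed L \<Delta> (tsubst \<theta> t) (Star \<tau>)"
    using BForall.prems(1,2) by (auto intro: typed_tsubst_subst)
  have imp: "proves L (\<tau> # \<Delta>) (plug [] 1 ` \<Phi>) (Imp ?M (?A fst))"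
    using BForall.prems(4) unfolding eq proves_BForall_iff[OF t] proves_Forall_iff .
  then have wf: "wf_fm L (\<tau> # \<Delta>) ?M" using wf_fm_proves[OF imp] by simp
  have "proves L (\<tau> # \<Delta>) ?\<Psi> (Imp ?M (?A fst))" using imp by (rule proves_mono) auto
  then have "proves L (\<tau> # \<Delta>) ?\<Psi> (?A fst)" by (rule ImpE) (intro Assm wf, simp)
  moreover have "list_all2 (sq_pair L ([\<tau>] @ \<Delta>) ?\<Psi>) ?qs (HRtys (BForall \<tau> t A))"
    using BForall.prems(3) by (rule sq_pairs_lift) auto
  ultimately have "proves L (\<tau> # \<Delta>) ?\<Psi> (?A snd)"
    using BForall.prems(1)
    by (intro BForall.IH[OF _ typed_subst_lift_assign[OF BForall.prems(2)]]) auto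
  then show ?case
    unfolding eq proves_BForall_iff[OF t] proves_Forall_iff using wf by (rule ImpI)
next
  case (BExists \<tau> t A)
  let ?\<theta> = "assign [Var 0] (\<lambda>i. lift 1 (\<theta> i))"
  let ?qs = "map (map_prod (lift 1) (lift 1)) ps"
  let ?A = "\<lambda>f. subst (assign (map f ?qs) ?\<theta>) (HRm A)"
  \<comment> \<open>Again the bound does not depend on the realizers, so the witness keeps its
    membership unchanged.\<close>
  let ?M = "Mem \<tau> (Var 0) (lift 1 (tsubst \<theta> t))"
  let ?\<Psi> = "insert (And ?M (?A fst)) (plug [] 1 ` \<Phi>)"
  have len: "length ps = length (HRtys A)" using list_all2_lengthD[OF BExists.prems(3)] by simp
  have eq: "subst (assign (map fst ps) \<theta>) (HRm (BExists \<tau> t A)) = BExists \<tau> (tsubst \<theta> t) (?A fst)"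
    "subst (assign (map snd ps) \<theta>) (HRm (BExists \<tau> t A)) = BExists \<tau> (tsubst \<theta> t) (?A snd)"
    using len by (simp_all add: subst_HRm_BExists comp_def del: HRm.simps)
  have t: "typed L \<Delta> (tsubst \<theta> t) (Star \<tau>)"
    using BExists.prems(1,2) by (auto intro: typed_tsubst_subst)
  have ex: "proves L \<Delta> \<Phi> (Exists \<tau> (And ?M (?A fst)))"
    using BExists.prems(4) unfolding eq proves_BExists_iff[OF t] .
  have "wf_fm L (\<tau> # \<Delta>) (And ?M (?A fst))" using wf_fm_proves[OF ex] by simp
  then have hyp: "proves L (\<tau> # \<Delta>) ?\<Psi> (And ?M (?A fst))" by (intro Assm) simp_all
  have "list_all2 (sq_pair L ([\<tau>] @ \<Delta>) ?\<Psi>) ?qs (HRtys (BExists \<tau> t A))"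
    using BExists.prems(3) by (rule sq_pairs_lift) auto
  then have "proves L (\<tau> # \<Delta>) ?\<Psi> (?A snd)"
    using BExists.prems(1) AndE2[OF hyp]
    by (intro BExists.IH[OF _ typed_subst_lift_assign[OF BExists.prems(2)]]) auto
  then show ?case
    unfolding eq proves_BExists_iff[OF t]
    by (intro proves_Exists_mono[OF ex] AndI AndE1[OF hyp])
\<comment> \<open>For an atomic formula the tuple is empty and the two instances coincide.\<close>
qed auto

section \<open>From term instances to tuples of variables\<close>

lemma proves_ConjsD: "proves L \<Gamma> \<Phi> (Conjs As) \<Longrightarrow> A \<in> set As \<Longrightarrow> proves L \<Gamma> \<Phi> A"
proof (induction As rule: Conjs.induct)
  case (3 B C As)
  from "3.prems"(1) have "proves L \<Gamma> \<Phi> (And B (Conjs (C # As)))" by simp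
  from AndE1[OF this] AndE2[OF this] "3.IH" "3.prems"(2) show ?case by auto
qed simp_all

lemma wf_fm_Conjs: "(\<And>A. A \<in> set As \<Longrightarrow> wf_fm L \<Gamma> A) \<Longrightarrow> wf_fm L \<Gamma> (Conjs As)"
  by (induction As rule: Conjs.induct) auto

lemma wf_fm_sqsub:
  "end_star \<sigma> \<Longrightarrow> typed L \<Gamma> a \<sigma> \<Longrightarrow> typed L \<Gamma> b \<sigma> \<Longrightarrow> wf_fm L \<Gamma> (sqsub \<sigma> a b)"
proof (induction \<sigma> arbitrary: \<Gamma> a b)
  case (Arr \<rho> \<sigma>)
  then show ?case
    using typed_lift[of L \<Gamma> _ "\<rho> \<rightarrow> \<sigma>" 1 "[\<rho>]"]
    by (auto intro!: Arr.IH(2) typed_App[where \<sigma> = \<rho>] intro: typed_Var')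
next
  case (Star \<tau>)
  then show ?case
    using typed_lift[of L \<Gamma> _ "Star \<tau>" 1 "[\<tau>]"] by (auto intro: typed_Var')
qed simp

theorem theorem5:
  fixes L :: "('f, 'r) lang" and \<Gamma> :: "ty list" and A :: "('f, 'r) fm"
  assumes "\<exists>c \<in> funs L. farity L c = 0"
    and "wf_fm L \<Gamma> A"
  shows "let \<sigma>s = HRtys A; n = length \<sigma>s; x = tvars n n; x' = tvars 0 n
    in proves L (rev (\<sigma>s @ \<sigma>s) @ \<Gamma>) {}
      (Imp (And (sqsubs \<sigma>s x x') (plug x (n + n) (HRm A))) (plug x' (n + n) (HRm A)))"
proof -
  define \<sigma>s n where "\<sigma>s = HRtys A" and "n = length \<sigma>s"
  define x x' :: "'f trm list" where "x = tvars n n" and "x' = tvars 0 n"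
  define \<Delta> where "\<Delta> = rev (\<sigma>s @ \<sigma>s) @ \<Gamma>"
  \<comment> \<open>The free variables of \<open>A\<close> lie outside both tuples of length
    \<open>n\<close>.\<close>
  define \<theta> :: "nat \<Rightarrow> 'f trm" where "\<theta> = (\<lambda>i. Var (i + (n + n)))"
  define H where "H = And (sqsubs \<sigma>s x x') (plug x (n + n) (HRm A))"
  have len: "length x = n" "length x' = n" "length \<sigma>s = n"
    by (simp_all add: x_def x'_def n_def)
  have plug: "plug ts (n + n) (HRm A) = subst (assign ts \<theta>) (HRm A)" for ts
    by (simp add: plug_def inst_eq_assign \<theta>_def)
  have x: "list_all2 (typed L \<Delta>) x \<sigma>s"
    using typed_tvars[of "rev \<sigma>s" n \<sigma>s n L \<Gamma>] len(3) unfolding x_def \<Delta>_def by simp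
  have x': "list_all2 (typed L \<Delta>) x' \<sigma>s"
    using typed_tvars[of "[]" 0 \<sigma>s n L "rev \<sigma>s @ \<Gamma>"] len(3) unfolding x'_def \<Delta>_def by simp
  have \<theta>: "typed_subst L \<Delta> \<theta> \<Gamma>"
    unfolding \<Delta>_def \<theta>_def by (rule typed_subst_weaken) (simp add: len)
  \<comment> \<open>Indexing the conjuncts by position matches the pointwise reading of
    \<open>list_all2\<close>.\<close>
  have sqs: "sqsubs \<sigma>s x x' = Conjs (map (\<lambda>i. sqsub (\<sigma>s ! i) (x ! i) (x' ! i)) [0..<n])"
    unfolding sqsubs_def by (intro arg_cong[of _ _ Conjs] nth_equalityI) (auto simp: len)
  have "wf_fm L \<Delta> (sqsub (\<sigma>s ! i) (x ! i) (x' ! i))" if "i < n" for i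
    using that x x' len end_star_HRtys[of "\<sigma>s ! i" A]
    by (intro wf_fm_sqsub) (auto simp: list_all2_conv_all_nth \<sigma>s_def)
  then have "wf_fm L \<Delta> (sqsubs \<sigma>s x x')" unfolding sqs by (intro wf_fm_Conjs) auto
  moreover have "wf_fm L \<Delta> (plug x (n + n) (HRm A))"
    unfolding plug using assms(2) \<theta> x[unfolded \<sigma>s_def] by (rule wf_fm_subst_HRm)
  ultimately have wf: "wf_fm L \<Delta> H" by (simp add: H_def)
  then have H: "proves L \<Delta> {H} H" by (simp add: Assm)
  have "proves L \<Delta> {H} (sqsub (\<sigma>s ! i) (x ! i) (x' ! i))" if "i < n" for i
    \<comment> \<open>Unfolding \<open>H_def\<close> also reaches the hypothesis set; folding
      restores \<open>{H}\<close> there.\<close>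
    by (rule proves_ConjsD[OF H[unfolded H_def, THEN AndE1, folded H_def, unfolded sqs]])
      (use that in auto)
  then have "list_all2 (sq_pair L \<Delta> {H}) (zip x x') (HRtys A)"
    using x x' len by (auto simp: list_all2_conv_all_nth sq_pair_def simp flip: \<sigma>s_def)
  moreover have "proves L \<Delta> {H} (subst (assign (map fst (zip x x')) \<theta>) (HRm A))"
    using H[unfolded H_def, THEN AndE2, folded H_def] len by (simp add: plug)
  ultimately have "proves L \<Delta> {H} (subst (assign (map snd (zip x x')) \<theta>) (HRm A))"
    by (rule proves_HRm_mono[OF assms(2) \<theta>])
  then have "proves L \<Delta> {H} (plug x' (n + n) (HRm A))" using len by (simp add: plug)
  then have "proves L \<Delta> {} (Imp H (plug x' (n + n) (HRm A)))" using wf by (rule ImpI)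
  then show ?thesis 
    unfolding Let_def H_def \<Delta>_def x_def x'_def n_def \<sigma>s_def .
qed

end
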